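(* Let $n\ge 2$ and let $Y$ be a transcendental real analytic submanifold of $\mathbb R^n$ of dimension $d\ge 2$. Suppose that for each $k\in\mathbb N$ a non-increasing function $f_k:\mathbb R_{>0}\to\mathbb R_{>0}$ is given. Then there is a dense uncountable set of $\mathbf{x}\in Y$ which are not algebraic and are $f_k$-uniform of degree $k$ for all $k\in\mathbb N$. In particular, $Y$ contains a dense uncountable set of $\mathbf{x}$ which are not algebraic and are $k$-singular for all $k\in\mathbb N$.
   Context: A submanifold $Y\subset\mathbb R^n$ is transcendental if no nonzero polynomial in $\mathbb Z[X_1,\dots,X_n]$ vanishes identically on $Y$. For $P\in\mathbb Z[X_1,\dots,X_n]$, $H(P)$ is the maximum absolute value of its coefficients and $\deg P$ its total degree. For non-increasing $f:\mathbb R_{>0}\to\mathbb R_{>0}$, $\mathbf{x}\in\mathbb R^n$ is $f$-uniform of degree $k$ if for every sufficiently large $t$ there is a nonzero $P\in\mathbb Z[X_1,\dots,X_n]$ with $\deg P\le k$, $H(P)\le t$ and $|P(\mathbf{x})|\le f(t)$. With $N(k,n)=\binom{k+n}{n}-1$, $\mathbf{x}$ is $k$-singular if for every $\varepsilon>0$ it is $f$-uniform of degree $k$ for $f(t)=\varepsilon t^{-N(k,n)}$. $\mathbf{x}$ is $k$-algebraic if $P(\mathbf{x})=0$ for some nonzero $P\in\mathbb Z[X_1,\dots,X_n]$ with $\deg P=k$, and algebraic if it is $k$-algebraic for some $k$.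
   Formalization: Y is additionally assumed connected: for disconnected Y the claim fails, e.g. the union of {(x,y,e^x)} and the plane z=-1 in R^3, where all points with z=-1 are algebraic. ℕ is read as the positive integers. *)

theory Defs
  imports "HOL-Analysis.Analysis" "HOL-Library.Poly_Mapping"
begin

section \<open>Integer polynomials in the coordinates of \<open>real ^ 'n\<close>\<close>

text \<open>Coefficients are indexed by exponent vectors, so the variables \<open>X_i\<close> are indexed by \<open>'n\<close>.\<close>

type_synonym 'n int_mpoly = "('n \<Rightarrow>\<^sub>0 nat) \<Rightarrow>\<^sub>0 int"

definition monom_eval :: "('n \<Rightarrow>\<^sub>0 nat) \<Rightarrow> real ^ 'n \<Rightarrow> real" where
  "monom_eval m x = (\<Prod>i\<in>UNIV. (x $ i) ^ Poly_Mapping.lookup m i)"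

definition mpoly_eval :: "'n int_mpoly \<Rightarrow> real ^ 'n \<Rightarrow> real" where
  "mpoly_eval P x = (\<Sum>m\<in>Poly_Mapping.keys P. of_int (Poly_Mapping.lookup P m) * monom_eval m x)"

text \<open>The zero polynomial gets degree \<open>0\<close>; only nonzero polynomials matter below.\<close>

definition mpoly_degree :: "('n::finite) int_mpoly \<Rightarrow> nat" where
  "mpoly_degree P = Max (insert 0 ((\<lambda>m. \<Sum>i\<in>UNIV. Poly_Mapping.lookup m i) ` Poly_Mapping.keys P))"

definition mpoly_height :: "'n int_mpoly \<Rightarrow> int" where
  "mpoly_height P = Max (insert 0 ((\<lambda>m. \<bar>Poly_Mapping.lookup P m\<bar>) ` Poly_Mapping.keys P))"

section \<open>Algebraic, uniform and singular points\<close>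

definition k_algebraic :: "nat \<Rightarrow> real ^ 'n \<Rightarrow> bool" where
  "k_algebraic k x \<longleftrightarrow> (\<exists>P. P \<noteq> 0 \<and> mpoly_degree P = k \<and> mpoly_eval P x = 0)"

definition algebraic_point :: "real ^ 'n \<Rightarrow> bool" where
  "algebraic_point x \<longleftrightarrow> (\<exists>k. k_algebraic k x)"

text \<open>A function on the positive reals is represented by a total function \<open>real \<Rightarrow> real\<close>;
  its values at nonpositive arguments are irrelevant, since only large \<open>t\<close> are considered.\<close>

definition f_uniform :: "(real \<Rightarrow> real) \<Rightarrow> nat \<Rightarrow> real ^ 'n \<Rightarrow> bool" where
  "f_uniform f k x \<longleftrightarrow>
    (\<forall>\<^sub>F t in at_top. \<exists>P. P \<noteq> 0 \<and> mpoly_degree P \<le> k \<and>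
       of_int (mpoly_height P) \<le> t \<and> \<bar>mpoly_eval P x\<bar> \<le> f t)"

definition N_exp :: "nat \<Rightarrow> nat \<Rightarrow> nat" where
  "N_exp k n = ((k + n) choose n) - 1"

definition k_singular :: "nat \<Rightarrow> real ^ 'n \<Rightarrow> bool" where
  "k_singular k (x :: real ^ 'n) \<longleftrightarrow>
    (\<forall>\<epsilon>>0. f_uniform (\<lambda>t. \<epsilon> * t powr - real (N_exp k CARD('n))) k x)"

section \<open>Real analytic submanifolds\<close>

text \<open>A map is real analytic on a set if near each of its points it is the sum of an
  (unconditionally convergent) multivariate power series centred there.\<close>

definition real_analytic_on ::
    "(real ^ 'm \<Rightarrow> 'b::real_normed_vector) \<Rightarrow> (real ^ 'm) set \<Rightarrow> bool" where
  "real_analytic_on g U \<longleftrightarrow>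
    (\<forall>a\<in>U. \<exists>r>0. \<exists>c. \<forall>x\<in>ball a r.
       ((\<lambda>m. monom_eval m (x - a) *\<^sub>R c m) has_sum g x) UNIV)"

text \<open>Embedded submanifolds, given by slice charts: near each of its points, \<open>Y\<close> is carried by
  an analytic diffeomorphism \<open>\<Phi>\<close> (with inverse \<open>\<Psi>\<close>) between open subsets of the ambient space
  onto a piece of the \<open>d\<close>-dimensional coordinate subspace spanned by the coordinates in \<open>I\<close>.\<close>

definition real_analytic_submanifold :: "nat \<Rightarrow> (real ^ 'n) set \<Rightarrow> bool" where
  "real_analytic_submanifold d Y \<longleftrightarrow>
    (\<forall>y\<in>Y. \<exists>V W \<Phi> \<Psi>. \<exists>I :: 'n set.
       open V \<and> y \<in> V \<and> open W \<and> homeomorphism V W \<Phi> \<Psi> \<and>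
       real_analytic_on \<Phi> V \<and> real_analytic_on \<Psi> W \<and>
       card I = d \<and> \<Phi> ` (Y \<inter> V) = W \<inter> {z. \<forall>i. i \<notin> I \<longrightarrow> z $ i = 0})"

definition transcendental_set :: "(real ^ 'n) set \<Rightarrow> bool" where
  "transcendental_set Y \<longleftrightarrow> \<not> (\<exists>P. P \<noteq> 0 \<and> (\<forall>y\<in>Y. mpoly_eval P y = 0))"

end

theory Submission
  imports Defs "HOL-Complex_Analysis.Cauchy_Integral_Formula"
begin

text \<open>Integer polynomials of the form \<open>b X_j - a\<close> suffice. Near a point of \<open>Y\<close> where no nonzero
  integer polynomial vanishes (Baire), take a two-dimensional analytic slice of \<open>Y\<close>; two of the
  ambient coordinates restrict to local coordinates \<open>(s, t)\<close> on it. Alternate between lines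
  \<open>s = a/b\<close> and \<open>t = a'/b'\<close>: each new line is made to cross the previous one, and only after its
  height is known is the next, tiny ball placed near the crossing point, so the previous linear form is
  as small there as the functions \<open>f k\<close> demand. The limit point is uniform for all \<open>f k\<close> at once.

  To make it avoid countably many analytic zero sets \<open>h = 0\<close> (those of integer polynomials, and of
  \<open>X_j - c_j\<close> to avoid a given countable set of points \<open>c\<close>), one has to choose \<open>t = a'/b'\<close> so that
  \<open>h\<close> does not vanish identically on this line near \<open>s = a/b\<close>. If all rational \<open>t\<close> failed, let
  \<open>n\<close> be the minimal vanishing order of \<open>h\<close> along \<open>s = a/b\<close>. The leading form of degree \<open>n\<close> is then
  invariant under translation along the line \<open>s = a/b\<close> and vanishes in the transversal direction,
  hence is zero: a contradiction.\<close>

section \<open>Functions analytic along lines\<close>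

text \<open>The order of choices is the main obstacle. The rational value \<open>t\<close> of a new
  line fixes its height, the height fixes how close to the old line the next point must lie, and
  only after that is the point picked off the zero set of \<open>h\<close>. One \<open>t\<close>
  must therefore serve for every distance \<delta>: density of the complement of the zero set is not
  enough, \<open>h\<close> must be nonzero on the new line arbitrarily close to the crossing point.
  A second obstacle is that the coordinates (s, t) come from the inverse function theorem, used in
  its continuously differentiable form. So \<open>h\<close> is studied on the parameter plane, where
  it is analytic, and the coordinate lines become differentiable curves there. Leading forms are
  compared along such curves by difference quotients whose base points and directions move; this
  calls for Taylor coefficients that are jointly continuous in base point and direction, with one
  bound for all of them.\<close>

text \<open>The complex extension along real lines is all that is needed from real analyticity: the class is
  visibly closed under sums, products and affine substitutions, and Cauchy's inequalities bound the
  Taylor coefficients along all lines through points near \<open>y\<close> uniformly.\<close>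

definition line_extension ::
    "('a::real_normed_vector \<Rightarrow> real) \<Rightarrow> 'a \<Rightarrow> real \<Rightarrow> ('a \<Rightarrow> 'a \<Rightarrow> complex \<Rightarrow> complex) \<Rightarrow> real \<Rightarrow> bool" where
  "line_extension h y r E B \<longleftrightarrow> r > 0 \<and> (\<forall>z\<in>ball y r. \<forall>w\<in>ball 0 r.
     E z w holomorphic_on ball 0 2 \<and> (\<forall>\<tau>\<in>ball 0 2. norm (E z w \<tau>) \<le> B) \<and>
     (\<forall>\<tau>. \<bar>\<tau>\<bar> < 2 \<longrightarrow> E z w (of_real \<tau>) = of_real (h (z + \<tau> *\<^sub>R w))))"

definition line_analytic_at :: "('a::real_normed_vector \<Rightarrow> real) \<Rightarrow> 'a \<Rightarrow> bool" where
  "line_analytic_at h y \<longleftrightarrow> (\<exists>r E B. line_extension h y r E B)"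

lemma line_analytic_atI:
  fixes h :: "'a::real_normed_vector \<Rightarrow> real"
  assumes "r > 0"
    and "\<And>z w. z \<in> ball y r \<Longrightarrow> w \<in> ball 0 r \<Longrightarrow> \<exists>e.
     e holomorphic_on ball 0 2 \<and> (\<forall>\<tau>\<in>ball 0 2. norm (e \<tau>) \<le> B) \<and>
     (\<forall>\<tau>. \<bar>\<tau>\<bar> < 2 \<longrightarrow> e (of_real \<tau>) = of_real (h (z + \<tau> *\<^sub>R w)))"
  shows "line_analytic_at h y"
proof -
  obtain E where "\<And>z w. z\<in>ball y r \<Longrightarrow> w\<in>ball 0 r \<Longrightarrow>
     E z w holomorphic_on ball 0 2 \<and> (\<forall>\<tau>\<in>ball 0 2. norm (E z w \<tau>) \<le> B) \<and>
     (\<forall>\<tau>. \<bar>\<tau>\<bar> < 2 \<longrightarrow> E z w (of_real \<tau>) = of_real (h (z + \<tau> *\<^sub>R w)))"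
    using assms(2) by metis
  then have "line_extension h y r E B" using assms(1) unfolding line_extension_def by blast
  then show ?thesis unfolding line_analytic_at_def by blast
qed

lemma line_analytic_atE:
  fixes h :: "'a::real_normed_vector \<Rightarrow> real"
  assumes "line_analytic_at h y"
  obtains r E B where "line_extension h y r E B"
  using assms unfolding line_analytic_at_def by blast

lemma line_extensionD:
  assumes "line_extension h y r E B"
  shows "r > 0"
    "z \<in> ball y r \<Longrightarrow> w \<in> ball 0 r \<Longrightarrow> E z w holomorphic_on ball 0 2"
    "z \<in> ball y r \<Longrightarrow> w \<in> ball 0 r \<Longrightarrow> \<tau> \<in> ball 0 2 \<Longrightarrow> norm (E z w \<tau>) \<le> B"
    "z \<in> ball y r \<Longrightarrow> w \<in> ball 0 r \<Longrightarrow> \<bar>t\<bar> < 2 \<Longrightarrow>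
       E z w (of_real t) = of_real (h (z + t *\<^sub>R w))"
  using assms unfolding line_extension_def by blast+

section \<open>Closure under ring operations and affine substitution\<close>

lemma line_analytic_at_const: "line_analytic_at (\<lambda>x. c) y"
  by (rule line_analytic_atI[of 1 _ "\<bar>c\<bar>"]) (auto intro!: exI[of _ "\<lambda>\<tau>. of_real c"])

text \<open>Sum and product share this argument: \<open>opc\<close> combines the complex extensions,
  \<open>opr\<close> the real values, and \<open>Bop\<close> the two bounds, so that the resulting
  bound is again uniform over all lines.\<close>

lemma line_analytic_at_binop:
  fixes g h :: "'a::real_normed_vector \<Rightarrow> real"
  assumes g: "line_analytic_at g y" and h: "line_analytic_at h y"
    and hol: "\<And>d e. d holomorphic_on ball 0 2 \<Longrightarrow> e holomorphic_on ball 0 2 \<Longrightarrow>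
           (\<lambda>\<tau>. opc (d \<tau>) (e \<tau>)) holomorphic_on ball 0 2"
    and bnd: "\<And>a b A B. norm a \<le> A \<Longrightarrow> norm b \<le> B \<Longrightarrow> norm (opc a b) \<le> Bop A B"
    and real: "\<And>a b. opc (of_real a) (of_real b) = of_real (opr a b)"
  shows "line_analytic_at (\<lambda>x. opr (g x) (h x)) y"
proof -
  obtain r D A where "line_extension g y r D A"
    using g by (rule line_analytic_atE)
  note D = line_extensionD[OF this]
  obtain s E B where "line_extension h y s E B"
    using h by (rule line_analytic_atE)
  note E = line_extensionD[OF this]
  show ?thesis
  proof (rule line_analytic_atI[of "min r s" _ "Bop A B"])
    fix z w :: 'a assume zw: "z \<in> ball y (min r s)" "w \<in> ball 0 (min r s)"
    then have "z \<in> ball y r" "z \<in> ball y s" "w \<in> ball 0 r" "w \<in> ball 0 s" by auto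
    note D' = D(2-4)[OF this(1,3)] and E' = E(2-4)[OF this(2,4)]
    show "\<exists>e. e holomorphic_on ball 0 2 \<and> (\<forall>\<tau>\<in>ball 0 2. norm (e \<tau>) \<le> Bop A B) \<and>
     (\<forall>\<tau>. \<bar>\<tau>\<bar> < 2 \<longrightarrow> e (of_real \<tau>) = of_real (opr (g (z + \<tau> *\<^sub>R w)) (h (z + \<tau> *\<^sub>R w))))"
      by (intro exI[of _ "\<lambda>\<tau>. opc (D z w \<tau>) (E z w \<tau>)"] conjI ballI allI impI
            hol bnd D'(1,2) E'(1,2))
         (assumption | (subst D'(3), assumption, subst E'(3), assumption, rule real))+
  qed (use D(1) E(1) in auto)
qed

lemma line_analytic_at_add:
  assumes "line_analytic_at g y" "line_analytic_at h y"
  shows "line_analytic_at (\<lambda>x. g x + h x) y"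
  by (rule line_analytic_at_binop[where opc = "(+)" and Bop = "(+)", OF assms])
     (auto intro!: holomorphic_intros order_trans[OF norm_triangle_ineq] add_mono)

lemma line_analytic_at_mult:
  assumes "line_analytic_at g y" "line_analytic_at h y"
  shows "line_analytic_at (\<lambda>x. g x * h x) y"
  by (rule line_analytic_at_binop[where opc = "(*)" and Bop = "(*)", OF assms])
     (auto intro!: holomorphic_intros mult_mono' simp: norm_mult)

lemma line_analytic_at_power:
  "line_analytic_at g y \<Longrightarrow> line_analytic_at (\<lambda>x. g x ^ k) y"
  by (induction k) (auto intro: line_analytic_at_const line_analytic_at_mult)

lemma line_analytic_at_sum:
  "(\<And>i. i \<in> I \<Longrightarrow> line_analytic_at (g i) y) \<Longrightarrow> line_analytic_at (\<lambda>x. \<Sum>i\<in>I. g i x) y"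
  by (induction I rule: infinite_finite_induct)
     (auto intro: line_analytic_at_const line_analytic_at_add)

lemma line_analytic_at_prod:
  "(\<And>i. i \<in> I \<Longrightarrow> line_analytic_at (g i) y) \<Longrightarrow> line_analytic_at (\<lambda>x. \<Prod>i\<in>I. g i x) y"
  by (induction I rule: infinite_finite_induct)
     (auto intro: line_analytic_at_const line_analytic_at_mult)

lemma line_analytic_at_compose_affine:
  fixes h :: "'b::real_normed_vector \<Rightarrow> real" and A :: "'a::real_normed_vector \<Rightarrow> 'b"
  assumes "line_analytic_at h (A y + c)" and A: "bounded_linear A"
  shows "line_analytic_at (\<lambda>x. h (A x + c)) y"
proof -
  interpret A: bounded_linear A by fact
  obtain r E B where "line_extension h (A y + c) r E B"
    using assms(1) by (rule line_analytic_atE)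
  note E = line_extensionD[OF this]
  obtain K where K: "K > 0" "\<And>x. norm (A x) \<le> norm x * K"
    using A.pos_bounded by blast
  have sm: "norm (A x) < r" if "norm x < r / K" for x
    using K(2)[of x] that K(1) by (simp add: field_simps)
  show ?thesis
  proof (rule line_analytic_atI[of "r / K" _ B])
    fix z w :: 'a assume zw: "z \<in> ball y (r/K)" "w \<in> ball 0 (r/K)"
    have "A z + c \<in> ball (A y + c) r"
      using sm[of "y - z"] zw by (simp add: dist_norm A.diff)
    moreover have "A w \<in> ball 0 r" using sm[of w] zw by simp
    ultimately have E': "E (A z + c) (A w) holomorphic_on ball 0 2"
      "\<And>\<tau>. \<tau> \<in> ball 0 2 \<Longrightarrow> norm (E (A z + c) (A w) \<tau>) \<le> B"
      "\<And>\<tau>. \<bar>\<tau>\<bar> < 2 \<Longrightarrow> E (A z + c) (A w) (of_real \<tau>) = of_real (h (A z + c + \<tau> *\<^sub>R A w))"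
      using E by blast+
    have eq: "A (z + \<tau> *\<^sub>R w) + c = A z + c + \<tau> *\<^sub>R A w" for \<tau> by (simp add: A.add A.scaleR)
    show "\<exists>e. e holomorphic_on ball 0 2 \<and> (\<forall>\<tau>\<in>ball 0 2. norm (e \<tau>) \<le> B) \<and>
     (\<forall>\<tau>. \<bar>\<tau>\<bar> < 2 \<longrightarrow> e (of_real \<tau>) = of_real (h (A (z + \<tau> *\<^sub>R w) + c)))"
      unfolding eq using E' by (intro exI[of _ "E (A z + c) (A w)"]) auto
  qed (use E(1) K(1) in auto)
qed

section \<open>Taylor coefficients along lines, with uniform bounds\<close>

definition taylor_family ::
    "('a::real_normed_vector \<Rightarrow> real) \<Rightarrow> 'a \<Rightarrow> real \<Rightarrow> real \<Rightarrow> (nat \<Rightarrow> 'a \<Rightarrow> 'a \<Rightarrow> real) \<Rightarrow> bool" where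
  "taylor_family h y r B T \<longleftrightarrow> r > 0 \<and> (\<forall>z\<in>ball y r. \<forall>w\<in>ball 0 r.
     (\<forall>M. \<bar>T M z w\<bar> \<le> B) \<and> (\<forall>\<tau>. \<bar>\<tau>\<bar> < 2 \<longrightarrow> (\<lambda>M. T M z w * \<tau> ^ M) sums h (z + \<tau> *\<^sub>R w)))"

text \<open>\<open>T M z w\<close> is the degree \<open>M\<close> Taylor form of \<open>h\<close> at
  \<open>z\<close>, evaluated at \<open>w\<close>. Cauchy's inequality on the unit circle bounds all
  of them by the same \<open>B\<close>, because the extension lives on the disc of radius 2; that
  radius also admits \<tau> = 1, so the series recovers \<open>h (z + w)\<close>.\<close>

lemma line_analytic_at_taylor:
  fixes h :: "'a::real_normed_vector \<Rightarrow> real"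
  assumes "line_analytic_at h y"
  obtains r B T where "taylor_family h y r B T"
proof -
  obtain r E B where "line_extension h y r E B"
    using assms by (rule line_analytic_atE)
  note E = line_extensionD[OF this]
  define T where "T M z w = Re ((deriv ^^ M) (E z w) 0 / fact M)" for M z w
  have "taylor_family h y r B T" unfolding taylor_family_def
  proof (intro conjI ballI allI impI)
    fix z w :: 'a and M assume zw: "z\<in>ball y r" "w\<in>ball 0 r"
    have hol: "E z w holomorphic_on ball 0 2" using E(2) zw by blast
    have "norm ((deriv ^^ M) (E z w) 0) \<le> fact M * B / 1 ^ M"
    proof (rule Cauchy_inequality)
      show "E z w holomorphic_on ball 0 1" "continuous_on (cball 0 1) (E z w)"
        by (auto intro!: holomorphic_on_imp_continuous_on holomorphic_on_subset[OF hol])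
    qed (use E(3)[OF zw] in auto)
    then have "norm ((deriv ^^ M) (E z w) 0 / fact M) \<le> B"
      by (simp add: norm_divide field_simps)
    then show "\<bar>T M z w\<bar> \<le> B" unfolding T_def using abs_Re_le_cmod order_trans by blast
    fix \<tau> :: real assume \<tau>: "\<bar>\<tau>\<bar> < 2"
    have *: "(\<lambda>n. (deriv ^^ n) (E z w) 0 / (fact n) * (of_real \<tau> - 0) ^ n) sums E z w (of_real \<tau>)"
      by (rule holomorphic_power_series[OF hol]) (use \<tau> in auto)
    have eq: "Re (X * (of_real \<tau> - 0) ^ n) = Re X * \<tau> ^ n" for X n
      by (simp flip: of_real_power)
    show "(\<lambda>M. T M z w * \<tau> ^ M) sums h (z + \<tau> *\<^sub>R w)"
      using sums_Re[OF *] by (simp only: eq E(4)[OF zw \<tau>] T_def Re_complex_of_real)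
  qed (use E(1) in auto)
  then show ?thesis using that by blast
qed

text \<open>The tail is dominated by a geometric series of ratio 1/2, whence the factor 2. For a
  Taylor family the constant is thus independent of base point and direction.\<close>

lemma bounded_power_series_remainder:
  fixes a :: "nat \<Rightarrow> real"
  assumes "(\<lambda>M. a M * x ^ M) sums s" "\<And>M. \<bar>a M\<bar> \<le> B" "\<bar>x\<bar> \<le> 1/2"
  shows "\<bar>s - (\<Sum>M<n. a M * x ^ M)\<bar> \<le> 2 * B * \<bar>x\<bar> ^ n"
proof -
  have B: "B \<ge> 0" using assms(2)[of 0] by linarith
  have "(\<lambda>i. a (i + n) * x ^ (i + n)) sums (s - (\<Sum>M<n. a M * x ^ M))"
    by (rule sums_split_initial_segment[OF assms(1)])
  moreover have "(\<lambda>i. B * \<bar>x\<bar> ^ n * (1/2) ^ i) sums (B * \<bar>x\<bar> ^ n * (1 / (1 - 1/2)))"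
    by (intro sums_mult geometric_sums) auto
  moreover have "norm (a (i + n) * x ^ (i + n)) \<le> B * \<bar>x\<bar> ^ n * (1/2) ^ i" for i
  proof -
    have "norm (a (i + n) * x ^ (i + n)) = \<bar>a (i + n)\<bar> * (\<bar>x\<bar> ^ n * \<bar>x\<bar> ^ i)"
      by (simp add: abs_mult power_abs power_add mult_ac)
    also have "\<dots> \<le> B * (\<bar>x\<bar> ^ n * (1/2) ^ i)"
      by (intro mult_mono assms power_mono) (use B in auto)
    finally show ?thesis by (simp add: mult_ac)
  qed
  ultimately have "norm (s - (\<Sum>M<n. a M * x ^ M)) \<le> B * \<bar>x\<bar> ^ n * (1 / (1 - 1/2))"
    by (rule norm_sums_le)
  then show ?thesis by simp
qed

lemma power_series_coeff_zero:
  fixes a :: "nat \<Rightarrow> real"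
  assumes "s > 0" "\<And>x. \<bar>x\<bar> < s \<Longrightarrow> (\<lambda>M. a M * x ^ M) sums 0"
  shows "a M = 0"
proof -
  have a0: "a 0 = 0" using assms(2)[of 0] assms(1) powser_sums_zero_iff by force
  show ?thesis
  proof (cases "M = 0")
    case False
    show ?thesis
    proof (rule ccontr)
      assume "a M \<noteq> 0"
      obtain t where "0 < t" "\<And>z. z \<in> cball 0 t - {0} \<Longrightarrow> (\<lambda>x::real. 0::real) z \<noteq> 0"
        by (rule powser_0_nonzero[of s 0 a "\<lambda>x. 0" M]) (use assms False \<open>a M \<noteq> 0\<close> in auto)
      then show False by (metis Diff_iff abs_of_pos dist_0_norm less_eq_real_def mem_cball
            real_norm_def singletonD order_less_irrefl)
    qed
  qed (use a0 in simp)
qed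

lemma taylor_familyD:
  assumes "taylor_family h y r B T"
  shows taylor_family_pos: "r > 0"
    and taylor_family_bound: "z \<in> ball y r \<Longrightarrow> w \<in> ball 0 r \<Longrightarrow> \<bar>T M z w\<bar> \<le> B"
    and taylor_family_sums: "z \<in> ball y r \<Longrightarrow> w \<in> ball 0 r \<Longrightarrow> \<bar>\<tau>\<bar> < 2 \<Longrightarrow>
      (\<lambda>M. T M z w * \<tau> ^ M) sums h (z + \<tau> *\<^sub>R w)"
  using assms unfolding taylor_family_def by blast+

lemma taylor_family_remainder:
  assumes "taylor_family h y r B T" "z \<in> ball y r" "w \<in> ball 0 r" "\<bar>\<tau>\<bar> \<le> 1/2"
  shows "\<bar>h (z + \<tau> *\<^sub>R w) - (\<Sum>M<n. T M z w * \<tau> ^ M)\<bar> \<le> 2 * B * \<bar>\<tau>\<bar> ^ n"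
  using assms(4)
  by (intro bounded_power_series_remainder taylor_family_sums[OF assms(1-3)]
        taylor_family_bound[OF assms(1-3)]) auto

lemma taylor_family_0:
  assumes "taylor_family h y r B T" "z \<in> ball y r" "w \<in> ball 0 r"
  shows "T 0 z w = h z"
  using taylor_family_sums[OF assms, of 0] sums_unique2[OF powser_sums_zero] by fastforce

text \<open>Rescaling the variable in the series along \<open>w\<close> gives the series along the
  shortened direction, and power series coefficients are unique.\<close>

lemma taylor_family_homogeneous:
  assumes "taylor_family h y r B T" "z \<in> ball y r" "w \<in> ball 0 r" "\<bar>\<alpha>\<bar> \<le> 1"
  shows "T M z (\<alpha> *\<^sub>R w) = \<alpha> ^ M * T M z w"
proof -
  have "norm (\<alpha> *\<^sub>R w) \<le> norm w" using assms(4) by (simp add: mult_left_le_one_le)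
  then have w: "\<alpha> *\<^sub>R w \<in> ball 0 r" using assms(3) by simp
  have "(\<lambda>M. (T M z (\<alpha> *\<^sub>R w) - \<alpha> ^ M * T M z w) * x ^ M) sums 0" if "\<bar>x\<bar> < 1" for x
  proof -
    have "\<bar>x * \<alpha>\<bar> \<le> \<bar>x\<bar>" using assms(4) by (simp add: abs_mult mult_left_le)
    then have x: "\<bar>x\<bar> < 2" "\<bar>x * \<alpha>\<bar> < 2" using that by auto
    show ?thesis
      using sums_diff[OF taylor_family_sums[OF assms(1,2) w x(1)]
          taylor_family_sums[OF assms(1-3) x(2)]]
      by (simp add: algebra_simps power_mult_distrib)
  qed
  then have "T M z (\<alpha> *\<^sub>R w) - \<alpha> ^ M * T M z w = 0"
    by (intro power_series_coeff_zero[of 1]) auto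
  then show ?thesis by simp
qed

lemma taylor_family_isCont:
  fixes h :: "'a::real_normed_vector \<Rightarrow> real"
  assumes T: "taylor_family h y r B T" and x: "x \<in> ball y r"
  shows "isCont h x"
proof -
  have r: "r > 0" by (rule taylor_family_pos[OF T])
  have "((\<lambda>v. h (x + v) - h x) \<longlongrightarrow> 0) (at 0)"
  proof (rule Lim_null_comparison)
    show "((\<lambda>v. 2 * B * (norm v * (2 / r))) \<longlongrightarrow> 0) (at 0)"
      using r by (auto intro!: tendsto_eq_intros)
    have "\<forall>\<^sub>F v in at 0. norm v < r / 4 \<and> v \<noteq> 0"
      using r by (auto simp: eventually_at intro!: exI[of _ "r/4"])
    then show "\<forall>\<^sub>F v in at 0. norm (h (x + v) - h x) \<le> 2 * B * (norm v * (2 / r))"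
    proof eventually_elim
      case (elim v)
      \<comment> \<open>\<open>v\<close> is written as a small multiple of a vector of fixed length
        r/2, which makes the remainder of order 1 linear in the norm of \<open>v\<close>.\<close>
      let ?w = "(r / 2 / norm v) *\<^sub>R v" let ?\<tau> = "norm v * (2 / r)"
      have "\<bar>h (x + ?\<tau> *\<^sub>R ?w) - (\<Sum>M<1. T M x ?w * ?\<tau> ^ M)\<bar> \<le> 2 * B * \<bar>?\<tau>\<bar> ^ 1"
        by (rule taylor_family_remainder[OF T x]) (use r elim in \<open>auto simp: field_simps\<close>)
      moreover have "T 0 x ?w = h x"
        by (rule taylor_family_0[OF T x]) (use r elim in auto)
      moreover have "?\<tau> *\<^sub>R ?w = v" using r elim by simp
      ultimately show ?case using r by (simp only:) (simp add: abs_mult)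
    qed
  qed
  then show ?thesis unfolding isCont_iff by (simp add: LIM_zero_iff)
qed

text \<open>\<open>T n\<close> is the uniform limit, as \<tau> tends to 0 from the right, of the
  quotients \<open>q \<tau>\<close>, which involve only \<open>h\<close> and lower coefficients. The
  radius r/2 keeps \<open>z + \<tau> *\<^sub>R w\<close> in the ball where \<open>h\<close> is
  continuous.\<close>

lemma taylor_family_continuous:
  fixes h :: "'a::real_normed_vector \<Rightarrow> real"
  assumes T: "taylor_family h y r B T"
  shows "continuous_on (ball y (r/2) \<times> ball 0 (r/2)) (\<lambda>(z,w). T M z w)"
proof (induction M rule: less_induct)
  case (less n)
  have r: "r > 0" by (rule taylor_family_pos[OF T])
  have B: "B \<ge> 0" using taylor_family_bound[OF T, of y 0 0] r by force
  let ?S = "ball y (r/2) \<times> ball (0::'a) (r/2)"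
  define q where "q \<tau> p = (h (fst p + \<tau> *\<^sub>R snd p) - (\<Sum>M<n. T M (fst p) (snd p) * \<tau> ^ M)) / \<tau> ^ n"
    for \<tau> p
  have "\<forall>\<^sub>F \<tau> in at_right 0. continuous_on ?S (q \<tau>)"
  proof -
    have "\<forall>\<^sub>F \<tau> in at_right 0. 0 < \<tau> \<and> \<tau> < (1::real)"
      by (auto simp: eventually_at_right_field intro: exI[of _ 1])
    then show ?thesis
    proof eventually_elim
      case (elim \<tau>)
      have "continuous_on ?S (\<lambda>p. h (fst p + \<tau> *\<^sub>R snd p))"
      proof (rule continuous_on_compose2[of "ball y r" h])
        show "continuous_on (ball y r) h"
          using taylor_family_isCont[OF T] by (simp add: continuous_at_imp_continuous_on)
        show "(\<lambda>p. fst p + \<tau> *\<^sub>R snd p) ` ?S \<subseteq> ball y r"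
        proof (clarsimp simp: dist_norm)
          fix z w :: 'a assume "norm (y - z) * 2 < r" "norm w * 2 < r"
          moreover have "norm (y - (z + \<tau> *\<^sub>R w)) \<le> norm (y - z) + \<tau> * norm w"
            using norm_triangle_ineq4[of "y - z" "\<tau> *\<^sub>R w"] elim by (simp add: algebra_simps)
          moreover have "\<tau> * norm w \<le> norm w" using elim by (simp add: mult_left_le_one_le)
          ultimately show "norm (y - (z + \<tau> *\<^sub>R w)) < r" by linarith
        qed
      qed (auto intro!: continuous_intros)
      moreover have "continuous_on ?S (\<lambda>p. T M (fst p) (snd p))" if "M < n" for M
        using less[OF that] by (simp add: case_prod_unfold)
      ultimately show ?case unfolding q_def using elim by (intro continuous_intros) auto
    qed
  qed
  moreover have "uniform_limit ?S q (\<lambda>(z,w). T n z w) (at_right 0)"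
  proof (rule uniform_limitI)
    fix e :: real assume "e > 0"
    define \<delta> where "\<delta> = min (1/2) (e / (2 * B + 1))"
    have "\<delta> > 0" using \<open>e > 0\<close> B by (simp add: \<delta>_def)
    then have "\<forall>\<^sub>F \<tau> in at_right 0. 0 < \<tau> \<and> \<tau> < \<delta>"
      by (auto simp: eventually_at_right_field)
    then show "\<forall>\<^sub>F \<tau> in at_right 0. \<forall>p\<in>?S. dist (q \<tau> p) (case p of (z, w) \<Rightarrow> T n z w) < e"
    proof eventually_elim
      case (elim \<tau>)
      then have \<tau>: "0 < \<tau>" "\<bar>\<tau>\<bar> \<le> 1/2" "\<tau> * (2 * B + 1) < e"
        using B by (auto simp: \<delta>_def field_simps)
      show ?case
      proof (clarsimp)
        fix z w :: 'a assume zw: "dist y z * 2 < r" "norm w * 2 < r"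
        have "\<bar>h (z + \<tau> *\<^sub>R w) - (\<Sum>M<Suc n. T M z w * \<tau> ^ M)\<bar> \<le> 2 * B * \<bar>\<tau>\<bar> ^ Suc n"
          by (rule taylor_family_remainder[OF T]) (use zw \<tau> r in \<open>auto intro: le_less_trans[rotated]\<close>)
        also have "\<dots> = (2 * B * \<tau>) * \<tau> ^ n" using \<tau> by simp
        also have "\<bar>h (z + \<tau> *\<^sub>R w) - (\<Sum>M<Suc n. T M z w * \<tau> ^ M)\<bar> =
              dist (q \<tau> (z, w)) (T n z w) * \<tau> ^ n"
        proof -
          have "q \<tau> (z, w) * \<tau> ^ n = h (z + \<tau> *\<^sub>R w) - (\<Sum>M<n. T M z w * \<tau> ^ M)"
            using \<tau> by (simp add: q_def)
          then have "h (z + \<tau> *\<^sub>R w) - (\<Sum>M<Suc n. T M z w * \<tau> ^ M) = (q \<tau> (z, w) - T n z w) * \<tau> ^ n"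
            by (simp add: left_diff_distrib)
          then show ?thesis using \<tau> by (simp add: dist_real_def abs_mult)
        qed
        finally have "dist (q \<tau> (z, w)) (T n z w) \<le> 2 * B * \<tau>" using \<tau> by simp
        then show "dist (q \<tau> (z, w)) (T n z w) < e" using \<tau> by (simp add: algebra_simps)
      qed
    qed
  qed
  ultimately show ?case
    by (rule uniform_limit_theorem) auto
qed

section \<open>Vanishing order, identity theorem and derivatives\<close>

text \<open>Phrased by growth rather than by Taylor coefficients, so that the order at a point does
  not refer to a chosen family and families with different centres can be compared.\<close>

definition vanishes_to_order :: "('a::real_normed_vector \<Rightarrow> real) \<Rightarrow> 'a \<Rightarrow> nat \<Rightarrow> bool" where
  "vanishes_to_order h z N \<longleftrightarrow> (\<exists>K. \<forall>\<^sub>F v in nhds 0. \<bar>h (z + v)\<bar> \<le> K * norm v ^ N)"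

lemma taylor_family_leading_term:
  assumes T: "taylor_family h y r B T" and z: "z \<in> ball y r" and w: "w \<in> ball 0 r"
    and "\<bar>\<tau>\<bar> \<le> 1/2" and low: "\<And>M. M < n \<Longrightarrow> T M z w = 0"
  shows "\<bar>h (z + \<tau> *\<^sub>R w) - T n z w * \<tau> ^ n\<bar> \<le> 2 * B * \<bar>\<tau>\<bar> ^ Suc n"
  using taylor_family_remainder[OF assms(1-4), of "Suc n"] low by simp

text \<open>On a ray the lowest nonzero coefficient would dominate: after division by \<tau> ^ M
  both the remainder and the assumed growth bound tend to 0, which removes the coefficients below
  \<open>N\<close> one degree at a time. Conversely, when the Taylor sum is zero the remainder
  estimate is itself the growth bound.\<close>

lemma taylor_family_vanishes_iff:
  fixes h :: "'a::real_normed_vector \<Rightarrow> real"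
  assumes T: "taylor_family h y r B T" and z: "z \<in> ball y r"
  shows "vanishes_to_order h z N \<longleftrightarrow> (\<forall>M<N. \<forall>w\<in>ball 0 r. T M z w = 0)"
proof
  have r: "r > 0" by (rule taylor_family_pos[OF T])
  assume "vanishes_to_order h z N"
  then obtain K where K: "\<forall>\<^sub>F v in nhds 0. \<bar>h (z + v)\<bar> \<le> K * norm v ^ N"
    unfolding vanishes_to_order_def by blast
  have "T M z w = 0" if "M < N" and w: "w \<in> ball 0 r" for M w
    using that(1)
  proof (induction M rule: less_induct)
    case (less M)
    have "((\<lambda>\<tau>. \<tau> *\<^sub>R w) \<longlongrightarrow> 0) (at_right 0)"
      by (auto intro!: tendsto_eq_intros)
    then have "\<forall>\<^sub>F \<tau> in at_right 0. \<bar>h (z + \<tau> *\<^sub>R w)\<bar> \<le> K * norm (\<tau> *\<^sub>R w) ^ N"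
      using K by (rule eventually_compose_filterlim[rotated])
    moreover have "\<forall>\<^sub>F \<tau> in at_right 0. 0 < \<tau> \<and> \<tau> < (1/2::real)"
      by (auto simp: eventually_at_right_field intro: exI[of _ "1/2"])
    ultimately have "\<forall>\<^sub>F \<tau> in at_right 0. \<bar>T M z w\<bar> \<le> 2 * B * \<tau> + K * norm w ^ N * \<tau> ^ (N - M)"
    proof eventually_elim
      case (elim \<tau>)
      have "\<bar>h (z + \<tau> *\<^sub>R w) - T M z w * \<tau> ^ M\<bar> \<le> 2 * B * \<bar>\<tau>\<bar> ^ Suc M"
        by (rule taylor_family_leading_term[OF T z w]) (use elim less in auto)
      then have "\<bar>T M z w * \<tau> ^ M\<bar> \<le> 2 * B * \<bar>\<tau>\<bar> ^ Suc M + K * norm (\<tau> *\<^sub>R w) ^ N"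
        using elim by linarith
      moreover have "\<tau> ^ N = \<tau> ^ (N - M) * \<tau> ^ M"
        using less(2) by (simp flip: power_add)
      ultimately have "\<bar>T M z w\<bar> * \<tau> ^ M \<le> (2 * B * \<tau> + K * norm w ^ N * \<tau> ^ (N - M)) * \<tau> ^ M"
        using elim by (simp add: abs_mult power_mult_distrib algebra_simps)
      then show ?case using elim by simp
    qed
    moreover have "((\<lambda>\<tau>. 2 * B * \<tau> + K * norm w ^ N * \<tau> ^ (N - M)) \<longlongrightarrow> 0) (at_right 0)"
      using less(2) by (auto intro!: tendsto_eq_intros)
    ultimately have "\<bar>T M z w\<bar> \<le> 0"
      by (intro tendsto_lowerbound) auto
    then show ?case by simp
  qed
  then show "\<forall>M<N. \<forall>w\<in>ball 0 r. T M z w = 0" by blast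
next
  have r: "r > 0" by (rule taylor_family_pos[OF T])
  assume low: "\<forall>M<N. \<forall>w\<in>ball 0 r. T M z w = 0"
  have "\<bar>h (z + v)\<bar> \<le> 2 * B * (4 / r) ^ N * norm v ^ N" if "norm v < r / 8" for v
  proof (cases "v = 0")
    case True
    show ?thesis
    proof (cases "N = 0")
      case True
      have "\<bar>h z\<bar> \<le> B" "B \<ge> 0"
        using taylor_family_bound[OF T z, of 0 0] taylor_family_0[OF T z, of 0] r by auto
      then show ?thesis using \<open>v = 0\<close> True by simp
    next
      case False
      then have "h z = 0" using low taylor_family_0[OF T z, of 0] r by auto
      then show ?thesis using \<open>v = 0\<close> False by (simp add: power_0_left)
    qed
  next
    case False
    \<comment> \<open>Directions are normalised to length r/4, so \<open>?t\<close> is 4/r times the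
      norm of \<open>v\<close>; this is the source of (4 / r) ^ N, and norms below r/8 give
      \<open>?t\<close> below 1/2.\<close>
    let ?w = "(r / 4 / norm v) *\<^sub>R v" and ?t = "4 * norm v / r"
    have w: "?w \<in> ball 0 r" using r False by simp
    have "\<bar>h (z + ?t *\<^sub>R ?w) - (\<Sum>M<N. T M z ?w * ?t ^ M)\<bar> \<le> 2 * B * \<bar>?t\<bar> ^ N"
      by (rule taylor_family_remainder[OF T z w]) (use that r in \<open>auto simp: field_simps\<close>)
    moreover have "?t *\<^sub>R ?w = v" using r False by simp
    moreover have "(\<Sum>M<N. T M z ?w * ?t ^ M) = 0" using low w by simp
    moreover have "2 * B * \<bar>?t\<bar> ^ N = 2 * B * (4 / r) ^ N * norm v ^ N"
      using r by (simp add: abs_mult power_mult_distrib power_divide)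
    ultimately show ?thesis by (simp only: diff_0_right)
  qed
  then show "vanishes_to_order h z N" unfolding vanishes_to_order_def
    by (intro exI[of _ "2 * B * (4 / r) ^ N"])
       (use r in \<open>auto simp: eventually_nhds_metric intro!: exI[of _ "r/8"]\<close>)
qed

lemma taylor_family_flat:
  assumes T: "taylor_family h y r B T" and z: "z \<in> ball y r" and w: "w \<in> ball 0 r"
    and flat: "\<And>N. vanishes_to_order h z N"
  shows "h (z + w) = 0"
proof -
  have "T M z w = 0" for M
    using flat[of "Suc M"] taylor_family_vanishes_iff[OF T z] w by blast
  then show ?thesis
    using taylor_family_sums[OF T z w, of 1] by (simp add: sums_iff)
qed

lemma line_analytic_isCont:
  fixes h :: "'a::real_normed_vector \<Rightarrow> real"
  assumes "line_analytic_at h z"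
  shows "isCont h z"
proof -
  obtain r B T where T: "taylor_family h z r B T" by (rule line_analytic_at_taylor[OF assms])
  show ?thesis by (rule taylor_family_isCont[OF T]) (use taylor_family_pos[OF T] in simp)
qed

lemma vanishes_to_order_if_locally_zero:
  assumes "\<forall>\<^sub>F x in nhds z. h x = 0"
  shows "vanishes_to_order h z N"
proof -
  have "((\<lambda>v. z + v) \<longlongrightarrow> z) (nhds 0)"
    using tendsto_add[OF tendsto_const[of z] filterlim_ident, of "0"] by simp
  then have "\<forall>\<^sub>F v in nhds 0. h (z + v) = 0"
    using assms by (rule eventually_compose_filterlim[rotated])
  then show ?thesis unfolding vanishes_to_order_def
    by (intro exI[of _ 1]) (auto elim!: eventually_mono)
qed

lemma line_analytic_flat_imp_locally_zero:
  fixes h :: "'a::real_normed_vector \<Rightarrow> real"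
  assumes "line_analytic_at h z" "\<And>N. vanishes_to_order h z N"
  shows "\<forall>\<^sub>F x in nhds z. h x = 0"
proof -
  obtain r B T where T: "taylor_family h z r B T" by (rule line_analytic_at_taylor[OF assms(1)])
  have r: "r > 0" by (rule taylor_family_pos[OF T])
  have "h x = 0" if "dist x z < r" for x
    using taylor_family_flat[OF T, of z "x - z"] assms(2) that r by (simp add: dist_norm norm_minus_commute)
  then show ?thesis using r by (auto simp: eventually_nhds_metric)
qed

text \<open>The family at \<open>y\<close> has the same radius \<open>r\<close> at every centre
  \<open>z\<close> in \<open>ball y r\<close>. Flatness at \<open>z\<close> therefore kills
  \<open>h\<close> on \<open>ball z r\<close>, which contains \<open>y\<close>. This is the
  closedness half of the identity theorem.\<close>

lemma line_analytic_zero_propagates: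
  fixes h :: "'a::real_normed_vector \<Rightarrow> real"
  assumes "line_analytic_at h y"
  obtains r where "r > 0"
    "\<And>z. z \<in> ball y r \<Longrightarrow> \<forall>\<^sub>F x in nhds z. h x = 0 \<Longrightarrow> \<forall>\<^sub>F x in nhds y. h x = 0"
proof -
  obtain r B T where T: "taylor_family h y r B T" by (rule line_analytic_at_taylor[OF assms])
  have r: "r > 0" by (rule taylor_family_pos[OF T])
  show ?thesis
  proof (rule that[OF r])
    fix z assume z: "z \<in> ball y r" and "\<forall>\<^sub>F x in nhds z. h x = 0"
    have "h x = 0" if "x \<in> ball z r" for x
      using taylor_family_flat[OF T z, of "x - z"] that r
        vanishes_to_order_if_locally_zero[OF \<open>\<forall>\<^sub>F x in nhds z. h x = 0\<close>]
      by (simp add: dist_norm norm_minus_commute)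
    moreover have "\<forall>\<^sub>F x in nhds y. x \<in> ball z r"
      using z by (intro eventually_nhds_in_open) (auto simp: dist_commute)
    ultimately show "\<forall>\<^sub>F x in nhds y. h x = 0" by (auto elim: eventually_mono)
  qed
qed

lemma line_analytic_identity:
  fixes h :: "'a::real_normed_vector \<Rightarrow> real"
  assumes U: "open U" "connected U" and an: "\<And>x. x \<in> U \<Longrightarrow> line_analytic_at h x"
    and a: "a \<in> U" "\<forall>\<^sub>F x in nhds a. h x = 0" and b: "b \<in> U"
  shows "h b = 0"
proof -
  define Z where "Z = {x\<in>U. \<forall>\<^sub>F x in nhds x. h x = 0}"
  have "open Z" unfolding open_subopen[of Z]
  proof
    fix x assume "x \<in> Z"
    then obtain O' where "open O'" "x \<in> O'" "\<forall>x\<in>O'. h x = 0" "x \<in> U"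
      unfolding Z_def by (auto simp: eventually_nhds)
    then show "\<exists>T. open T \<and> x \<in> T \<and> T \<subseteq> Z" using U(1)
      by (intro exI[of _ "O' \<inter> U"]) (auto simp: Z_def eventually_nhds)
  qed
  moreover have "open (U - Z)" unfolding open_subopen[of "U - Z"]
  proof
    fix x assume x: "x \<in> U - Z"
    then obtain r where r: "r > 0"
      "\<And>z. z \<in> ball x r \<Longrightarrow> \<forall>\<^sub>F x in nhds z. h x = 0 \<Longrightarrow> \<forall>\<^sub>F x in nhds x. h x = 0"
      using line_analytic_zero_propagates[OF an[of x]] by blast
    then show "\<exists>T. open T \<and> x \<in> T \<and> T \<subseteq> U - Z" using U(1) x
      by (intro exI[of _ "ball x r \<inter> U"]) (auto simp: Z_def)
  qed
  moreover have "Z \<inter> (U - Z) \<inter> U = {}" "U \<subseteq> Z \<union> (U - Z)" by auto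
  moreover have "Z \<inter> U \<noteq> {}" using a by (auto simp: Z_def)
  ultimately have "(U - Z) \<inter> U = {}"
    using U(2) unfolding connected_def by blast
  then have "b \<in> Z" using b by blast
  then show ?thesis unfolding Z_def by (auto dest: eventually_nhds_x_imp_x)
qed

section \<open>First derivatives\<close>

lemma line_analytic_has_derivative:
  fixes h :: "'a::euclidean_space \<Rightarrow> real"
  assumes "line_analytic_at h y"
  obtains r D where "r > 0" "\<And>z. z \<in> ball y r \<Longrightarrow> (h has_derivative D z) (at z)"
    "\<And>v. continuous_on (ball y r) (\<lambda>z. D z v)"
proof -
  obtain r B T where T: "taylor_family h y r B T" by (rule line_analytic_at_taylor[OF assms])
  have r: "r > 0" by (rule taylor_family_pos[OF T])
  \<comment> \<open>\<open>T 1 z\<close> is controlled only on short vectors. The factor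
    \<open>\<rho> w\<close> shortens any direction below r/2, and \<open>D\<close> divides it out
    again.\<close>
  define \<rho> where "\<rho> w = r / (4 * (norm w + 1))" for w :: 'a
  define D where "D z w = T 1 z (\<rho> w *\<^sub>R w) / \<rho> w" for z w
  have \<rho>: "\<rho> w > 0" "norm (\<rho> w *\<^sub>R w) < r / 2" for w
  proof -
    have n: "norm w + 1 > 0" by (smt (verit) norm_ge_zero)
    show "\<rho> w > 0" using r n by (simp add: \<rho>_def)
    have "r * norm w < r * (2 * (norm w + 1))" using r n by (intro mult_strict_left_mono) auto
    then show "norm (\<rho> w *\<^sub>R w) < r / 2" using r n by (simp add: \<rho>_def divide_simps)
  qed
  have T1: "T 1 z (s *\<^sub>R w) = s * D z w" if z: "z \<in> ball y r" and s: "norm (s *\<^sub>R w) < r" for z s w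
  proof (cases "\<bar>s\<bar> \<le> \<rho> w")
    case True
    have "T 1 z ((s / \<rho> w) *\<^sub>R (\<rho> w *\<^sub>R w)) = (s / \<rho> w) ^ 1 * T 1 z (\<rho> w *\<^sub>R w)"
      by (rule taylor_family_homogeneous[OF T z]) (use \<rho>[of w] True r in auto)
    then show ?thesis using \<rho>(1)[of w] by (simp add: D_def)
  next
    case False
    have "T 1 z ((\<rho> w / s) *\<^sub>R (s *\<^sub>R w)) = (\<rho> w / s) ^ 1 * T 1 z (s *\<^sub>R w)"
      by (rule taylor_family_homogeneous[OF T z]) (use \<rho>[of w] False s in auto)
    moreover have "s \<noteq> 0" using False \<rho>(1)[of w] by auto
    ultimately show ?thesis using \<rho>(1)[of w] by (simp add: D_def)
  qed
  have cont: "continuous_on (ball y (r/2)) (\<lambda>z. D z v)" for v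
  proof -
    have "continuous_on (ball y (r/2)) (\<lambda>z. case (z, \<rho> v *\<^sub>R v) of (z, w) \<Rightarrow> T 1 z w)"
      by (rule continuous_on_compose2[OF taylor_family_continuous[OF T, of 1]])
         (use \<rho>[of v] in \<open>auto intro!: continuous_intros\<close>)
    then show ?thesis unfolding D_def using \<rho>[of v] by (auto intro!: continuous_intros)
  qed
  \<comment> \<open>The base point \<open>c \<alpha>\<close> is allowed to move. This yields
    additivity of \<open>D z\<close>: the increment along \<open>w + w'\<close> is split into one
    along \<open>w\<close> and one along \<open>w'\<close> from the displaced point, whereas
    expansions along single lines through \<open>z\<close> do not relate different
    directions.\<close>
  have quot: "((\<lambda>\<alpha>. (h (c \<alpha> + \<alpha> *\<^sub>R w) - h (c \<alpha>)) / \<alpha>) \<longlongrightarrow> D z w) (at_right 0)"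
    if c: "(c \<longlongrightarrow> z) (at_right 0)" and z: "z \<in> ball y (r/2)" for c z w
  proof -
    let ?s = "\<rho> w"
    have ev: "\<forall>\<^sub>F \<alpha> in at_right 0. c \<alpha> \<in> ball y (r/2)"
      using z by (intro topological_tendstoD[OF c]) auto
    have "((\<lambda>\<alpha>. D (c \<alpha>) w) \<longlongrightarrow> D z w) (at_right 0)"
      by (rule continuous_on_tendsto_compose[OF cont c z ev])
    moreover have "((\<lambda>\<alpha>. (h (c \<alpha> + \<alpha> *\<^sub>R w) - h (c \<alpha>)) / \<alpha> - D (c \<alpha>) w) \<longlongrightarrow> 0) (at_right 0)"
    proof (rule Lim_null_comparison)
      show "((\<lambda>\<alpha>. 2 * B / ?s\<^sup>2 * \<alpha>) \<longlongrightarrow> 0) (at_right 0)"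
        using \<rho>(1)[of w] by (auto intro!: tendsto_eq_intros)
      have "\<forall>\<^sub>F \<alpha> in at_right 0. 0 < \<alpha> \<and> \<alpha> < ?s / 2"
        using \<rho>(1)[of w] by (auto simp: eventually_at_right_field intro!: exI[of _ "?s/2"])
      then show "\<forall>\<^sub>F \<alpha> in at_right 0. norm ((h (c \<alpha> + \<alpha> *\<^sub>R w) - h (c \<alpha>)) / \<alpha> - D (c \<alpha>) w)
            \<le> 2 * B / ?s\<^sup>2 * \<alpha>"
        using ev
      proof eventually_elim
        case (elim \<alpha>)
        then have ca: "c \<alpha> \<in> ball y r" using r by auto
        have w0: "?s *\<^sub>R w \<in> ball 0 r" using \<rho>[of w] r by auto
        have "\<bar>h (c \<alpha> + (\<alpha> / ?s) *\<^sub>R (?s *\<^sub>R w)) - (\<Sum>M<2. T M (c \<alpha>) (?s *\<^sub>R w) * (\<alpha> / ?s) ^ M)\<bar>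
              \<le> 2 * B * \<bar>\<alpha> / ?s\<bar> ^ 2"
          by (rule taylor_family_remainder[OF T ca w0]) (use elim \<rho>(1)[of w] in \<open>auto simp: field_simps\<close>)
        moreover have "(\<Sum>M<2. T M (c \<alpha>) (?s *\<^sub>R w) * (\<alpha> / ?s) ^ M) = h (c \<alpha>) + \<alpha> * D (c \<alpha>) w"
          using T1[OF ca, of ?s w] w0 \<rho>(1)[of w] taylor_family_0[OF T ca w0]
          by (simp add: numeral_2_eq_2)
        moreover have "(\<alpha> / ?s) *\<^sub>R (?s *\<^sub>R w) = \<alpha> *\<^sub>R w" using \<rho>(1)[of w] by simp
        ultimately have "\<bar>h (c \<alpha> + \<alpha> *\<^sub>R w) - h (c \<alpha>) - \<alpha> * D (c \<alpha>) w\<bar> \<le> 2 * B * (\<alpha> / ?s)\<^sup>2"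
          using \<rho>(1)[of w] by (simp add: algebra_simps power_divide)
        moreover have "(h (c \<alpha> + \<alpha> *\<^sub>R w) - h (c \<alpha>)) / \<alpha> - D (c \<alpha>) w =
            (h (c \<alpha> + \<alpha> *\<^sub>R w) - h (c \<alpha>) - \<alpha> * D (c \<alpha>) w) / \<alpha>"
          using elim by (simp add: field_simps)
        ultimately show ?case using elim
          by (simp add: abs_divide divide_simps power2_eq_square mult_ac)
      qed
    qed
    ultimately show ?thesis using tendsto_add by fastforce
  qed
  have lin: "linear (D z)" if z: "z \<in> ball y (r/2)" for z
  proof (rule linearI)
    fix w w' :: 'a
    have "((\<lambda>\<alpha>. (h (z + \<alpha> *\<^sub>R w) - h z) / \<alpha> + (h (z + \<alpha> *\<^sub>R w + \<alpha> *\<^sub>R w') - h (z + \<alpha> *\<^sub>R w)) / \<alpha>)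
            \<longlongrightarrow> D z w + D z w') (at_right 0)"
      by (intro tendsto_add quot[OF _ z]) (auto intro!: tendsto_eq_intros)
    moreover have "(h (z + \<alpha> *\<^sub>R w) - h z) / \<alpha> + (h (z + \<alpha> *\<^sub>R w + \<alpha> *\<^sub>R w') - h (z + \<alpha> *\<^sub>R w)) / \<alpha>
        = (h (z + \<alpha> *\<^sub>R (w + w')) - h z) / \<alpha>" for \<alpha>
      by (simp add: scaleR_add_right add_ac flip: add_divide_distrib)
    ultimately have "((\<lambda>\<alpha>. (h (z + \<alpha> *\<^sub>R (w + w')) - h z) / \<alpha>) \<longlongrightarrow> D z w + D z w') (at_right 0)"
      by simp
    moreover have "((\<lambda>\<alpha>. (h (z + \<alpha> *\<^sub>R (w + w')) - h z) / \<alpha>) \<longlongrightarrow> D z (w + w')) (at_right 0)"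
      by (intro quot[OF _ z]) auto
    ultimately show "D z (w + w') = D z w + D z w'"
      by (intro tendsto_unique[of "at_right 0"]) auto
  next
    fix a :: real and w :: 'a
    have zr: "z \<in> ball y r" using z r by auto
    define s where "s = \<rho> (a *\<^sub>R w)"
    have s: "s > 0" "norm (s *\<^sub>R a *\<^sub>R w) < r" using \<rho>[of "a *\<^sub>R w"] r by (auto simp: s_def)
    have "s * D z (a *\<^sub>R w) = s * a * D z w"
      using T1[OF zr s(2)] T1[OF zr, of "s * a" w] s(2) by simp
    then show "D z (a *\<^sub>R w) = a *\<^sub>R D z w" using s(1) by simp
  qed
  have "(h has_derivative D z) (at z)" if z: "z \<in> ball y (r/2)" for z
  proof (rule has_derivativeI_sandwich[of "r/8" _ _ _ _ "\<lambda>x. 32 * B / r\<^sup>2 * norm (x - z)"])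
    show "r / 8 > 0" using r by simp
    show "bounded_linear (D z)" using lin[OF z] by (simp add: linear_conv_bounded_linear)
    show "((\<lambda>x. 32 * B / r\<^sup>2 * norm (x - z)) \<longlongrightarrow> 0) (at z)"
      using r by (auto intro!: tendsto_eq_intros)
    fix x assume x: "x \<noteq> z" "dist x z < r / 8"
    \<comment> \<open>The displacement is \<open>?t\<close> times a vector of length r/4; the bound
      2 * B * \<open>?t\<close> ^ 2 then produces the constant 32 * B / r ^ 2.\<close>
    let ?v = "x - z"
    let ?s = "r / 4 / norm ?v" and ?t = "4 * norm ?v / r"
    have zr: "z \<in> ball y r" using z r by auto
    have v: "norm ?v > 0" using x by simp
    have w: "?s *\<^sub>R ?v \<in> ball 0 r" using r v by simp
    have "\<bar>h (z + ?t *\<^sub>R (?s *\<^sub>R ?v)) - (\<Sum>M<2. T M z (?s *\<^sub>R ?v) * ?t ^ M)\<bar> \<le> 2 * B * \<bar>?t\<bar> ^ 2"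
      by (rule taylor_family_remainder[OF T zr w]) (use x r in \<open>auto simp: field_simps dist_norm\<close>)
    moreover have "?t *\<^sub>R (?s *\<^sub>R ?v) = ?v" using r v by simp
    moreover have "(\<Sum>M<2. T M z (?s *\<^sub>R ?v) * ?t ^ M) = h z + D z ?v"
      using T1[OF zr, of ?s ?v] w r v taylor_family_0[OF T zr w]
      by (simp add: numeral_2_eq_2)
    ultimately have "\<bar>h (z + ?v) - (h z + D z ?v)\<bar> \<le> 2 * B * \<bar>?t\<bar>\<^sup>2"
      by (simp only:)
    then have "\<bar>h x - h z - D z ?v\<bar> \<le> 2 * B * ?t\<^sup>2"
      unfolding power2_abs diff_diff_eq by simp
    also have "\<dots> = 32 * B / r\<^sup>2 * norm ?v * norm ?v"
      by (simp add: power2_eq_square)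
    finally show "norm (h x - h z - D z (x - z)) / norm (x - z) \<le> 32 * B / r\<^sup>2 * norm (x - z)"
      using v r by (simp add: divide_simps)
  qed
  then show ?thesis using that[of "r/2" D] r cont by simp
qed

section \<open>Real analytic maps and integer polynomials\<close>

lemma norm_monomial_le:
  fixes z :: "'n::finite \<Rightarrow> complex"
  assumes "\<And>i. norm (z i) \<le> \<rho>"
  shows "norm (\<Prod>i\<in>UNIV. z i ^ m i) \<le> (\<Prod>i\<in>UNIV. \<rho> ^ m i)"
  unfolding prod_norm[symmetric] norm_power by (intro prod_mono conjI power_mono assms) auto

text \<open>A summable family of reals is absolutely summable, so convergence at the one point
  \<open>a + p\<close>, offset by \<rho> in every coordinate, gives a majorant on the complex
  polydisc of radius \<rho>. By the Weierstrass test the series extends holomorphically along each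
  line, with the sum of the majorant as common bound.\<close>

lemma real_analytic_on_imp_line_analytic:
  fixes g :: "real ^ 'm::finite \<Rightarrow> real ^ 'n::finite"
  assumes "real_analytic_on g U" "a \<in> U"
  shows "line_analytic_at (\<lambda>x. g x $ i) a"
proof -
  obtain r c where r: "r > 0"
    and "\<forall>x\<in>ball a r. ((\<lambda>m. monom_eval m (x - a) *\<^sub>R c m) has_sum g x) UNIV"
    using assms unfolding real_analytic_on_def by blast
  then have c: "((\<lambda>m. monom_eval m (x - a) *\<^sub>R c m) has_sum g x) UNIV" if "x \<in> ball a r" for x
    using that by blast
  define C where "C m = c m $ i" for m
  have C: "((\<lambda>m. monom_eval m (x - a) * C m) has_sum g x $ i) UNIV" if "x \<in> ball a r" for x
    using has_sum_bounded_linear[OF bounded_linear_vec_nth c[OF that], of i]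
    by (simp add: C_def o_def)
  \<comment> \<open>The offsets add up to r/2 over all coordinates, which puts \<open>a + p\<close>
    into the ball of convergence.\<close>
  define \<rho> where "\<rho> = r / (2 * real CARD('m))"
  have card: "real CARD('m) \<ge> 1" using zero_less_card_finite[where 'a='m] by linarith
  have \<rho>: "\<rho> > 0" "\<rho> \<le> r / 2"
    using r card by (auto simp: \<rho>_def field_simps)
  define p :: "real ^ 'm" where "p = (\<chi> j. \<rho>)"
  have "norm p \<le> (\<Sum>j\<in>UNIV. \<bar>p $ j\<bar>)" by (rule norm_le_l1_cart)
  also have "\<dots> = r / 2" using \<rho> r card by (simp add: p_def \<rho>_def)
  finally have "a + p \<in> ball a r" using r by (simp add: dist_norm)
  from C[OF this] have "(\<lambda>m. monom_eval m p * C m) summable_on UNIV"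
    by (auto simp: summable_on_def)
  then have summ: "(\<lambda>m. \<bar>monom_eval m p * C m\<bar>) summable_on UNIV"
    using summable_on_iff_abs_summable_on_real[THEN iffD1] by fastforce
  define Bd where "Bd = (\<Sum>\<^sub>\<infinity>m. \<bar>monom_eval m p * C m\<bar>)"
  define t where "t z w m \<tau> = of_real (C m) *
     (\<Prod>j\<in>UNIV. (of_real ((z - a) $ j) + \<tau> * of_real (w $ j)) ^ Poly_Mapping.lookup m j)"
    for z w :: "real ^ 'm" and m and \<tau> :: complex
  define E where "E z w \<tau> = (\<Sum>\<^sub>\<infinity>m. t z w m \<tau>)" for z w \<tau>
  have t_bound: "norm (t z w m \<tau>) \<le> \<bar>monom_eval m p * C m\<bar>"
    if zw: "z \<in> ball a (\<rho>/4)" "w \<in> ball 0 (\<rho>/4)" and \<tau>: "norm \<tau> \<le> 2" for z w m \<tau>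
  proof -
    have "norm (of_real ((z - a) $ j) + \<tau> * of_real (w $ j)) \<le> \<rho>" for j
    proof -
      have "norm (of_real ((z - a) $ j) + \<tau> * of_real (w $ j)) \<le> \<bar>(z - a) $ j\<bar> + norm \<tau> * \<bar>w $ j\<bar>"
        by (rule order_trans[OF norm_triangle_ineq]) (simp add: norm_mult del: vector_minus_component)
      also have "\<dots> \<le> norm (z - a) + 2 * norm w"
        by (intro add_mono mult_mono component_le_norm_cart \<tau>) auto
      also have "\<dots> \<le> \<rho>" using zw \<rho>(1) by (simp add: dist_norm norm_minus_commute)
      finally show ?thesis .
    qed
    then have "norm (\<Prod>j\<in>UNIV. (of_real ((z - a) $ j) + \<tau> * of_real (w $ j)) ^ Poly_Mapping.lookup m j)
        \<le> (\<Prod>j\<in>UNIV. \<rho> ^ Poly_Mapping.lookup m j)"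
      by (rule norm_monomial_le[of "\<lambda>j. of_real ((z - a) $ j) + \<tau> * of_real (w $ j)" \<rho>
            "Poly_Mapping.lookup m"])
    also have "\<dots> = \<bar>monom_eval m p\<bar>"
      using \<rho> by (simp add: monom_eval_def p_def abs_prod power_abs)
    finally show ?thesis
      unfolding t_def by (simp add: norm_mult abs_mult mult.commute mult_left_mono)
  qed
  show ?thesis
  \<comment> \<open>With radius \<rho>/4 and \<tau> of modulus at most 2, every coordinate stays
    within \<rho>/4 + 2 \<rho>/4 < \<rho> of that of \<open>a\<close>.\<close>
  proof (rule line_analytic_atI[of "\<rho>/4" _ Bd])
    fix z w :: "real ^ 'm" assume zw: "z \<in> ball a (\<rho>/4)" "w \<in> ball 0 (\<rho>/4)"
    have "E z w holomorphic_on ball 0 2"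
    proof (rule holomorphic_uniform_limit)
      show "uniform_limit (cball 0 2) (\<lambda>X \<tau>. \<Sum>m\<in>X. t z w m \<tau>) (E z w) (finite_subsets_at_top UNIV)"
        unfolding E_def
        by (rule Weierstrass_m_test_general[OF _ summ]) (use t_bound[OF zw] in auto)
      show "\<forall>\<^sub>F X in finite_subsets_at_top UNIV. continuous_on (cball 0 2) (\<lambda>\<tau>. \<Sum>m\<in>X. t z w m \<tau>) \<and>
              (\<lambda>\<tau>. \<Sum>m\<in>X. t z w m \<tau>) holomorphic_on ball 0 2"
        unfolding t_def
        by (intro always_eventually allI conjI continuous_intros holomorphic_intros)
    qed auto
    moreover have "norm (E z w \<tau>) \<le> Bd" if "\<tau> \<in> ball 0 2" for \<tau>
    proof -
      have b: "norm (t z w m \<tau>) \<le> \<bar>monom_eval m p * C m\<bar>" for m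
        using t_bound[OF zw] that by simp
      then have "(\<lambda>m. t z w m \<tau>) summable_on UNIV"
        by (rule abs_summable_summable[OF Infinite_Sum.abs_summable_on_comparison_test'[OF summ]])
      then show ?thesis
        unfolding E_def Bd_def
        by (rule norm_infsum_le[OF has_sum_infsum has_sum_infsum[OF summ] b])
    qed
    moreover have "E z w (of_real \<tau>) = of_real (g (z + \<tau> *\<^sub>R w) $ i)" if \<tau>: "\<bar>\<tau>\<bar> < 2" for \<tau>
    proof -
      have "norm (z + \<tau> *\<^sub>R w - a) \<le> norm (z - a) + \<bar>\<tau>\<bar> * norm w"
        using norm_triangle_ineq[of "z - a" "\<tau> *\<^sub>R w"] by (simp add: algebra_simps)
      also have "\<dots> \<le> norm (z - a) + 2 * norm w" using \<tau> by (intro add_mono mult_right_mono) auto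
      also have "\<dots> < r" using zw \<rho> by (simp add: dist_norm norm_minus_commute)
      finally have "z + \<tau> *\<^sub>R w \<in> ball a r" by (simp add: dist_norm norm_minus_commute)
      from C[OF this] have "((\<lambda>m. of_real (monom_eval m (z + \<tau> *\<^sub>R w - a) * C m)) has_sum
          (of_real (g (z + \<tau> *\<^sub>R w) $ i) :: complex)) UNIV"
        by (rule has_sum_of_real)
      then have "((\<lambda>m. t z w m (of_real \<tau>)) has_sum of_real (g (z + \<tau> *\<^sub>R w) $ i)) UNIV"
        by (simp add: t_def monom_eval_def algebra_simps)
      then show ?thesis unfolding E_def by (rule infsumI)
    qed
    ultimately show "\<exists>e. e holomorphic_on ball 0 2 \<and> (\<forall>\<tau>\<in>ball 0 2. norm (e \<tau>) \<le> Bd) \<and>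
     (\<forall>\<tau>. \<bar>\<tau>\<bar> < 2 \<longrightarrow> e (of_real \<tau>) = of_real (g (z + \<tau> *\<^sub>R w) $ i))"
      by (intro exI[of _ "E z w"] conjI ballI allI impI)
  qed (use \<rho> in auto)
qed

lemma line_analytic_at_mpoly_eval:
  assumes "\<And>i. line_analytic_at (\<lambda>x. G x $ i) y"
  shows "line_analytic_at (\<lambda>x. mpoly_eval Q (G x)) y"
  unfolding mpoly_eval_def monom_eval_def
  by (intro line_analytic_at_sum line_analytic_at_mult line_analytic_at_prod
        line_analytic_at_power line_analytic_at_const assms)

lemma real_analytic_on_differentiable:
  fixes g :: "real ^ 'm::finite \<Rightarrow> real ^ 'n::finite"
  assumes "real_analytic_on g U" "a \<in> U"
  shows "g differentiable (at a)"
proof -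
  have "(\<lambda>x. g x $ i) differentiable (at a)" for i
  proof (rule line_analytic_has_derivative[OF real_analytic_on_imp_line_analytic[OF assms, of i]])
    fix r :: real and D
    assume "r > 0" and "\<And>z. z \<in> ball a r \<Longrightarrow> ((\<lambda>x. g x $ i) has_derivative D z) (at z)"
    then have "((\<lambda>x. g x $ i) has_derivative D a) (at a)" by simp
    then show ?thesis unfolding differentiable_def by blast
  qed
  then show ?thesis
    by (subst differentiable_componentwise_within) (auto simp: Basis_vec_def inner_axis)
qed

text \<open>Polynomials embed into the finite sets of pairs (exponent, coefficient), a zero
  coefficient being an absent exponent.\<close>

lemma countable_int_mpoly: "countable (UNIV :: 'n::finite int_mpoly set)"
proof -
  have "inj (Poly_Mapping.lookup :: ('n \<Rightarrow>\<^sub>0 nat) \<Rightarrow> 'n \<Rightarrow> nat)"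
    by (rule injI) (rule poly_mapping_eqI, simp)
  then have "countable (UNIV :: ('n \<Rightarrow>\<^sub>0 nat) set)"
    by (rule countable_image_inj_on[rotated]) simp
  then have c1: "countable (UNIV :: (('n \<Rightarrow>\<^sub>0 nat) \<times> int) set)"
    unfolding UNIV_Times_UNIV[symmetric] by (intro countable_SIGMA) auto
  define F where "F P = (\<lambda>m. (m, Poly_Mapping.lookup P m)) ` Poly_Mapping.keys P" for P :: "'n int_mpoly"
  have "inj F"
  proof (rule injI, rule poly_mapping_eqI)
    fix P Q :: "'n int_mpoly" and m assume eq: "F P = F Q"
    have "Poly_Mapping.lookup R m = c \<longleftrightarrow> (if c = 0 then m \<notin> fst ` F R else (m, c) \<in> F R)" for R c
      by (auto simp: F_def image_iff in_keys_iff)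
    from this[of P "Poly_Mapping.lookup P m"] this[of Q "Poly_Mapping.lookup P m"]
    show "Poly_Mapping.lookup P m = Poly_Mapping.lookup Q m" using eq by (simp split: if_splits)
  qed
  moreover have "range F \<subseteq> {A. finite A \<and> A \<subseteq> UNIV}" by (auto simp: F_def)
  moreover have "countable {A :: (('n \<Rightarrow>\<^sub>0 nat) \<times> int) set. finite A \<and> A \<subseteq> UNIV}"
    by (rule countable_Collect_finite_subset[OF c1])
  ultimately show ?thesis by (meson countable_image_inj_on countable_subset)
qed

section \<open>Level lines on which an analytic function does not vanish\<close>

text \<open>Vanishing to order \<open>n\<close> at the moving base point leaves
  \<open>T n (zf \<alpha>) (vf \<alpha>)\<close> up to an error 2 * B * \<alpha>, uniform in the
  base point, and \<open>T n\<close> is jointly continuous. Leading forms can thereby be read off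
  along curves instead of straight lines.\<close>

lemma taylor_family_limit:
  fixes h :: "'a::real_normed_vector \<Rightarrow> real"
  assumes T: "taylor_family h y r B T"
    and zf: "(zf \<longlongrightarrow> z) (at_right 0)" and vf: "(vf \<longlongrightarrow> w) (at_right 0)"
    and z: "z \<in> ball y (r/2)" and w: "w \<in> ball 0 (r/2)"
    and low: "\<forall>\<^sub>F \<alpha> in at_right 0. vanishes_to_order h (zf \<alpha>) n"
  shows "((\<lambda>\<alpha>. h (zf \<alpha> + \<alpha> *\<^sub>R vf \<alpha>) / \<alpha> ^ n) \<longlongrightarrow> T n z w) (at_right 0)"
proof -
  have r: "r > 0" by (rule taylor_family_pos[OF T])
  have evz: "\<forall>\<^sub>F \<alpha> in at_right 0. zf \<alpha> \<in> ball y (r/2)" and evw: "\<forall>\<^sub>F \<alpha> in at_right 0. vf \<alpha> \<in> ball 0 (r/2)"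
    using z w by (intro topological_tendstoD[OF zf] topological_tendstoD[OF vf]; auto)+
  have "((\<lambda>\<alpha>. case (zf \<alpha>, vf \<alpha>) of (z, w) \<Rightarrow> T n z w) \<longlongrightarrow> (case (z, w) of (z, w) \<Rightarrow> T n z w)) (at_right 0)"
  proof (rule continuous_on_tendsto_compose[OF taylor_family_continuous[OF T] tendsto_Pair[OF zf vf]])
    show "\<forall>\<^sub>F \<alpha> in at_right 0. (zf \<alpha>, vf \<alpha>) \<in> ball y (r/2) \<times> ball 0 (r/2)"
      using evz evw by eventually_elim auto
  qed (use z w in auto)
  then have "((\<lambda>\<alpha>. T n (zf \<alpha>) (vf \<alpha>)) \<longlongrightarrow> T n z w) (at_right 0)" by simp
  moreover have "((\<lambda>\<alpha>. h (zf \<alpha> + \<alpha> *\<^sub>R vf \<alpha>) / \<alpha> ^ n - T n (zf \<alpha>) (vf \<alpha>)) \<longlongrightarrow> 0) (at_right 0)"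
  proof (rule Lim_null_comparison)
    show "((\<lambda>\<alpha>. 2 * B * \<alpha>) \<longlongrightarrow> 0) (at_right 0)" by (auto intro!: tendsto_eq_intros)
    have "\<forall>\<^sub>F \<alpha> in at_right 0. 0 < \<alpha> \<and> \<alpha> < (1/2::real)"
      by (auto simp: eventually_at_right_field intro: exI[of _ "1/2"])
    then show "\<forall>\<^sub>F \<alpha> in at_right 0. norm (h (zf \<alpha> + \<alpha> *\<^sub>R vf \<alpha>) / \<alpha> ^ n - T n (zf \<alpha>) (vf \<alpha>)) \<le> 2 * B * \<alpha>"
      using evz evw low
    proof eventually_elim
      case (elim \<alpha>)
      have zr: "zf \<alpha> \<in> ball y r" and wr: "vf \<alpha> \<in> ball 0 r" using elim r by auto
      have "\<bar>h (zf \<alpha> + \<alpha> *\<^sub>R vf \<alpha>) - T n (zf \<alpha>) (vf \<alpha>) * \<alpha> ^ n\<bar> \<le> 2 * B * \<bar>\<alpha>\<bar> ^ Suc n"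
        by (rule taylor_family_leading_term[OF T zr wr])
           (use elim taylor_family_vanishes_iff[OF T zr] wr in auto)
      also have "\<dots> = (2 * B * \<alpha>) * \<alpha> ^ n" using elim by simp
      also have "h (zf \<alpha> + \<alpha> *\<^sub>R vf \<alpha>) - T n (zf \<alpha>) (vf \<alpha>) * \<alpha> ^ n =
          (h (zf \<alpha> + \<alpha> *\<^sub>R vf \<alpha>) / \<alpha> ^ n - T n (zf \<alpha>) (vf \<alpha>)) * \<alpha> ^ n"
        using elim by (simp add: left_diff_distrib)
      finally show ?case using elim by (simp add: abs_mult)
    qed
  qed
  ultimately show ?thesis using tendsto_add by fastforce
qed

text \<open>\<beta> may be negative or zero, so the chain rule at 0 is used rather than a
  substitution in the limit.\<close>

lemma has_vector_derivative_quotient: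
  assumes "(c has_vector_derivative c') (at t)"
  shows "((\<lambda>\<alpha>. (c (t + \<beta> * \<alpha>) - c t) /\<^sub>R \<alpha>) \<longlongrightarrow> \<beta> *\<^sub>R c') (at_right 0)"
proof -
  have "((\<lambda>\<alpha>. t + \<beta> * \<alpha>) has_vector_derivative \<beta>) (at 0)"
    by (auto intro!: derivative_eq_intros)
  then have "((\<lambda>\<alpha>. c (t + \<beta> * \<alpha>)) has_vector_derivative \<beta> *\<^sub>R c') (at 0)"
    using vector_diff_chain_at[of "\<lambda>\<alpha>. t + \<beta> * \<alpha>" \<beta> 0 c c'] assms by (simp add: o_def)
  then have "((\<lambda>\<alpha>. norm (c (t + \<beta> * \<alpha>) - c t - \<alpha> *\<^sub>R \<beta> *\<^sub>R c') / norm \<alpha>) \<longlongrightarrow> 0) (at 0)"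
    unfolding has_vector_derivative_def has_derivative_at by simp
  then have "((\<lambda>\<alpha>. norm (c (t + \<beta> * \<alpha>) - c t - \<alpha> *\<^sub>R \<beta> *\<^sub>R c') / norm \<alpha>) \<longlongrightarrow> 0) (at_right 0)"
    by (rule filterlim_mono) (auto simp: at_le)
  moreover have "\<forall>\<^sub>F \<alpha> in at_right 0. norm (c (t + \<beta> * \<alpha>) - c t - \<alpha> *\<^sub>R \<beta> *\<^sub>R c') / norm \<alpha> =
      norm ((c (t + \<beta> * \<alpha>) - c t) /\<^sub>R \<alpha> - \<beta> *\<^sub>R c')"
    using eventually_at_right_less[of 0]
  proof eventually_elim
    case (elim \<alpha>)
    have "(c (t + \<beta> * \<alpha>) - c t) /\<^sub>R \<alpha> - \<beta> *\<^sub>R c' = (c (t + \<beta> * \<alpha>) - c t - \<alpha> *\<^sub>R \<beta> *\<^sub>R c') /\<^sub>R \<alpha>"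
      using elim by (simp add: scaleR_diff_right)
    then show ?case using elim by (simp add: divide_inverse mult.commute)
  qed
  ultimately have "((\<lambda>\<alpha>. norm ((c (t + \<beta> * \<alpha>) - c t) /\<^sub>R \<alpha> - \<beta> *\<^sub>R c')) \<longlongrightarrow> 0) (at_right 0)"
    by (rule Lim_transform_eventually)
  then show ?thesis
    using LIM_zero_cancel tendsto_norm_zero_iff by blast
qed

text \<open>\<sigma> is the transversal derivative and \<tau> the tangent of the curve
  \<open>\<phi> q\<close>. Minimality of the order over the whole parameter interval makes
  \<open>h\<close> vanish to order \<open>n\<close> at the neighbouring base points, as the limits
  along the curve require. The point \<open>t1\<close> where the order is exact need not be
  rational; continuity of \<sigma> and of the Taylor form carries the vanishing over from rational
  parameters.\<close>

lemma good_rational_line: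
  fixes \<phi> :: "real \<Rightarrow> real \<Rightarrow> 'a::real_normed_vector" and h :: "'a \<Rightarrow> real"
  assumes "\<epsilon> > 0"
    and \<sigma>: "\<And>t. \<bar>t - t0\<bar> < \<epsilon> \<Longrightarrow> ((\<lambda>s. \<phi> s t) has_vector_derivative \<sigma> t) (at q)"
    and \<tau>: "\<And>t. \<bar>t - t0\<bar> < \<epsilon> \<Longrightarrow> (\<phi> q has_vector_derivative \<tau> t) (at t)"
    and cont: "continuous_on {t. \<bar>t - t0\<bar> < \<epsilon>} \<sigma>"
    and span: "\<And>t w. \<bar>t - t0\<bar> < \<epsilon> \<Longrightarrow> \<exists>a b. w = a *\<^sub>R \<sigma> t + b *\<^sub>R \<tau> t"
    and an: "\<And>t. \<bar>t - t0\<bar> < \<epsilon> \<Longrightarrow> line_analytic_at h (\<phi> q t)"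
    and nz: "\<And>t. \<bar>t - t0\<bar> < \<epsilon> \<Longrightarrow> \<not> (\<forall>\<^sub>F x in nhds (\<phi> q t). h x = 0)"
  shows "\<exists>t\<in>\<rat>. \<bar>t - t0\<bar> < \<epsilon> \<and> (\<exists>\<^sub>F s in nhds q. h (\<phi> s t) \<noteq> 0)"
proof (rule ccontr)
  assume "\<not> ?thesis"
  then have zero: "\<forall>\<^sub>F s in nhds q. h (\<phi> s t) = 0" if "t \<in> \<rat>" "\<bar>t - t0\<bar> < \<epsilon>" for t
    using that by (auto simp: frequently_def)
  define J where "J = {t. \<bar>t - t0\<bar> < \<epsilon>}"
  have J: "open J" "t0 \<in> J"
    using \<open>\<epsilon> > 0\<close> by (auto simp: J_def intro!: open_Collect_less continuous_intros)
  define P where "P N \<longleftrightarrow> (\<exists>t\<in>J. \<not> vanishes_to_order h (\<phi> q t) N)" for N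
  have "\<exists>N. P N"
    using line_analytic_flat_imp_locally_zero[OF an, of t0] nz[of t0] J \<open>\<epsilon> > 0\<close> by (auto simp: P_def)
  define N where "N = (LEAST N. P N)"
  have "P N" unfolding N_def by (rule LeastI_ex) fact
  have least: "\<not> P M" if "M < N" for M using not_less_Least that unfolding N_def by blast
  have "\<not> P 0"
  proof -
    have "vanishes_to_order h (\<phi> q t) 0" if t: "t \<in> J" for t
    proof -
      obtain r B T where T: "taylor_family h (\<phi> q t) r B T"
        using line_analytic_at_taylor[OF an] t unfolding J_def by blast
      show ?thesis
        by (subst taylor_family_vanishes_iff[OF T]) (use taylor_family_pos[OF T] in auto)
    qed
    then show ?thesis by (auto simp: P_def)
  qed
  \<comment> \<open>\<open>N\<close> is the first order that fails somewhere on the curve, so its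
    predecessor \<open>n\<close> is the order that holds on all of \<open>J\<close> and is exact at
    \<open>t1\<close>.\<close>
  with \<open>P N\<close> obtain n where n: "N = Suc n" by (cases N) auto
  have van: "vanishes_to_order h (\<phi> q t) n" if "t \<in> J" for t
    using least[of n] n that by (auto simp: P_def)
  obtain t1 where t1: "t1 \<in> J" "\<not> vanishes_to_order h (\<phi> q t1) (Suc n)"
    using \<open>P N\<close> n by (auto simp: P_def)
  let ?y = "\<phi> q t1"
  obtain r B T where T: "taylor_family h ?y r B T"
    using line_analytic_at_taylor[OF an[of t1]] t1 unfolding J_def by blast
  have r: "r > 0" by (rule taylor_family_pos[OF T])
  have y: "?y \<in> ball ?y r" "?y \<in> ball ?y (r/2)" using r by auto
  obtain w0 where w0: "w0 \<in> ball 0 r" "T n ?y w0 \<noteq> 0"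
  proof -
    obtain M w where Mw: "M < Suc n" "w \<in> ball 0 r" "T M ?y w \<noteq> 0"
      using t1 taylor_family_vanishes_iff[OF T y(1)] by blast
    moreover have "M = n"
      using Mw van[OF t1(1)] taylor_family_vanishes_iff[OF T y(1)] less_SucE by blast
    ultimately show ?thesis using that by blast
  qed
  obtain a b where ab: "w0 = a *\<^sub>R \<sigma> t1 + b *\<^sub>R \<tau> t1" using span[of t1 w0] t1 by (auto simp: J_def)
  \<comment> \<open>Homogeneity allows \<open>w0\<close> to be shrunk without losing a nonzero
    value; \<open>k\<close> brings both the transversal part and the full vector into the ball of
    radius r/2 where the coefficients are continuous. The summand 1 prevents a zero
    denominator.\<close>
  define k where "k = min 1 (r / (4 * (norm (a *\<^sub>R \<sigma> t1) + norm (b *\<^sub>R \<tau> t1) + 1)))"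
  define A where "A = k * a"
  define C where "C = k * b"
  have k: "0 < k" "k \<le> 1" "k * (norm (a *\<^sub>R \<sigma> t1) + norm (b *\<^sub>R \<tau> t1)) < r / 2"
  proof -
    define m where "m = norm (a *\<^sub>R \<sigma> t1) + norm (b *\<^sub>R \<tau> t1)"
    have m: "m \<ge> 0" by (simp add: m_def)
    show "0 < k" "k \<le> 1" using r m unfolding k_def m_def[symmetric] by auto
    have "k * m \<le> r / (4 * (m + 1)) * m"
      unfolding k_def m_def[symmetric] using m by (intro mult_right_mono) auto
    also have "\<dots> < r / 2"
    proof -
      have "r * m < r * (2 * (m + 1))" using r m by (intro mult_strict_left_mono) auto
      then show ?thesis using r m by (simp add: divide_simps)
    qed
    finally show "k * (norm (a *\<^sub>R \<sigma> t1) + norm (b *\<^sub>R \<tau> t1)) < r / 2" by (simp add: m_def)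
  qed
  have nA: "norm (A *\<^sub>R \<sigma> t1) + norm (C *\<^sub>R \<tau> t1) < r / 2"
    using k by (simp add: A_def C_def abs_mult distrib_left)
  have sm: "A *\<^sub>R \<sigma> t1 \<in> ball 0 (r/2)" "A *\<^sub>R \<sigma> t1 + C *\<^sub>R \<tau> t1 \<in> ball 0 (r/2)"
  proof -
    have "norm (A *\<^sub>R \<sigma> t1) < r / 2" "norm (A *\<^sub>R \<sigma> t1 + C *\<^sub>R \<tau> t1) < r / 2"
      using nA norm_triangle_ineq[of "A *\<^sub>R \<sigma> t1" "C *\<^sub>R \<tau> t1"]
        norm_ge_zero[of "C *\<^sub>R \<tau> t1"] by linarith+
    then show "A *\<^sub>R \<sigma> t1 \<in> ball 0 (r/2)" "A *\<^sub>R \<sigma> t1 + C *\<^sub>R \<tau> t1 \<in> ball 0 (r/2)"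
      by (simp_all del: norm_scaleR)
  qed
  have "T n ?y (k *\<^sub>R w0) = k ^ n * T n ?y w0"
    by (rule taylor_family_homogeneous[OF T y(1) w0(1)]) (use k in auto)
  then have nonzero: "T n ?y (A *\<^sub>R \<sigma> t1 + C *\<^sub>R \<tau> t1) \<noteq> 0"
    using w0(2) k(1) by (simp add: ab A_def C_def scaleR_add_right)
  have contq: "isCont (\<phi> q) t" if "t \<in> J" for t
    using \<tau>[of t] that by (intro has_vector_derivative_continuous) (auto simp: J_def)
  \<comment> \<open>The curve \<open>\<phi> q\<close> is tangent to \<open>\<tau> t1\<close> and \<open>h\<close> vanishes to order \<open>n\<close> along it, so the
    leading term at \<open>?y\<close> does not change under translations by multiples of \<open>\<tau> t1\<close>.\<close>
  have shift: "T n ?y (A *\<^sub>R \<sigma> t1 + C *\<^sub>R \<tau> t1) = T n ?y (A *\<^sub>R \<sigma> t1)"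
  proof -
    let ?zf = "\<lambda>\<alpha>. \<phi> q (t1 + C * \<alpha>)"
    \<comment> \<open>Chosen so that \<open>?zf \<alpha> + \<alpha> *\<^sub>R ?vf \<alpha>\<close>
      lies on the straight ray from \<open>?y\<close>. The same quotient, read from two base points,
      then has both values of the form as its limit.\<close>
    let ?vf = "\<lambda>\<alpha>. A *\<^sub>R \<sigma> t1 + (C *\<^sub>R \<tau> t1 - (?zf \<alpha> - ?y) /\<^sub>R \<alpha>)"
    have tt: "((\<lambda>\<alpha>. t1 + C * \<alpha>) \<longlongrightarrow> t1) (at_right 0)" by (auto intro!: tendsto_eq_intros)
    have zf: "(?zf \<longlongrightarrow> ?y) (at_right 0)"
      by (rule isCont_tendsto_compose[OF contq[OF t1(1)] tt])
    have "((\<lambda>\<alpha>. (?zf \<alpha> - ?y) /\<^sub>R \<alpha>) \<longlongrightarrow> C *\<^sub>R \<tau> t1) (at_right 0)"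
      using \<tau>[of t1] t1 by (intro has_vector_derivative_quotient) (auto simp: J_def)
    from tendsto_add[OF tendsto_const[of "A *\<^sub>R \<sigma> t1"] tendsto_diff[OF tendsto_const[of "C *\<^sub>R \<tau> t1"] this]]
    have vf: "(?vf \<longlongrightarrow> A *\<^sub>R \<sigma> t1) (at_right 0)" by simp
    have "\<forall>\<^sub>F \<alpha> in at_right 0. t1 + C * \<alpha> \<in> J"
      by (rule topological_tendstoD[OF tt J(1) t1(1)])
    then have "\<forall>\<^sub>F \<alpha> in at_right 0. vanishes_to_order h (?zf \<alpha>) n"
      by eventually_elim (rule van)
    from taylor_family_limit[OF T zf vf y(2) sm(1) this]
    have "((\<lambda>\<alpha>. h (?zf \<alpha> + \<alpha> *\<^sub>R ?vf \<alpha>) / \<alpha> ^ n) \<longlongrightarrow> T n ?y (A *\<^sub>R \<sigma> t1)) (at_right 0)" .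
    moreover have "\<forall>\<^sub>F \<alpha> in at_right 0. h (?zf \<alpha> + \<alpha> *\<^sub>R ?vf \<alpha>) / \<alpha> ^ n =
        h (?y + \<alpha> *\<^sub>R (A *\<^sub>R \<sigma> t1 + C *\<^sub>R \<tau> t1)) / \<alpha> ^ n"
      using eventually_at_right_less[of 0]
    proof eventually_elim
      case (elim \<alpha>)
      have "?zf \<alpha> + \<alpha> *\<^sub>R ?vf \<alpha> = ?y + \<alpha> *\<^sub>R (A *\<^sub>R \<sigma> t1 + C *\<^sub>R \<tau> t1)"
        using elim by (simp add: scaleR_add_right scaleR_diff_right)
      then show ?case by simp
    qed
    ultimately have "((\<lambda>\<alpha>. h (?y + \<alpha> *\<^sub>R (A *\<^sub>R \<sigma> t1 + C *\<^sub>R \<tau> t1)) / \<alpha> ^ n)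
        \<longlongrightarrow> T n ?y (A *\<^sub>R \<sigma> t1)) (at_right 0)"
      by (rule Lim_transform_eventually)
    moreover have "((\<lambda>\<alpha>. h (?y + \<alpha> *\<^sub>R (A *\<^sub>R \<sigma> t1 + C *\<^sub>R \<tau> t1)) / \<alpha> ^ n)
        \<longlongrightarrow> T n ?y (A *\<^sub>R \<sigma> t1 + C *\<^sub>R \<tau> t1)) (at_right 0)"
      by (rule taylor_family_limit[OF T _ _ y(2) sm(2)]) (auto simp: van t1)
    ultimately show ?thesis by (intro tendsto_unique[of "at_right 0"]) auto
  qed
  \<comment> \<open>For rational \<open>t\<close> the secants of s \<mapsto> \<phi> s t end at zeros
    of \<open>h\<close>, while their directions tend to
    \<open>A *\<^sub>R \<sigma> t\<close>.\<close>
  have rat: "T n (\<phi> q t) (A *\<^sub>R \<sigma> t) = 0"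
    if t: "t \<in> \<rat>" "t \<in> J" and "\<phi> q t \<in> ball ?y (r/2)" "A *\<^sub>R \<sigma> t \<in> ball 0 (r/2)" for t
  proof -
    let ?vf = "\<lambda>\<alpha>. (\<phi> (q + A * \<alpha>) t - \<phi> q t) /\<^sub>R \<alpha>"
    have vf: "(?vf \<longlongrightarrow> A *\<^sub>R \<sigma> t) (at_right 0)"
      using \<sigma>[of t] t by (intro has_vector_derivative_quotient) (auto simp: J_def)
    have lim: "((\<lambda>\<alpha>. h (\<phi> q t + \<alpha> *\<^sub>R ?vf \<alpha>) / \<alpha> ^ n) \<longlongrightarrow> T n (\<phi> q t) (A *\<^sub>R \<sigma> t)) (at_right 0)"
      by (rule taylor_family_limit[OF T _ vf]) (use that van in auto)
    have "((\<lambda>\<alpha>. q + A * \<alpha>) \<longlongrightarrow> q) (at_right 0)" by (auto intro!: tendsto_eq_intros)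
    moreover have "\<forall>\<^sub>F s in nhds q. h (\<phi> s t) = 0" using zero t by (simp add: J_def)
    ultimately have "\<forall>\<^sub>F \<alpha> in at_right 0. h (\<phi> (q + A * \<alpha>) t) = 0"
      by (rule eventually_compose_filterlim[rotated])
    then have "\<forall>\<^sub>F \<alpha> in at_right 0. h (\<phi> q t + \<alpha> *\<^sub>R ?vf \<alpha>) / \<alpha> ^ n = 0"
      using eventually_at_right_less[of 0] by eventually_elim simp
    with lim have "((\<lambda>\<alpha>. 0) \<longlongrightarrow> T n (\<phi> q t) (A *\<^sub>R \<sigma> t)) (at_right (0::real))"
      by (rule Lim_transform_eventually)
    then show ?thesis by (simp add: tendsto_const_iff)
  qed
  have "T n ?y (A *\<^sub>R \<sigma> t1) = 0"
  proof -
    have "t1 \<in> closure \<rat>" by (simp add: Rats_closure_real)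
    then obtain u where u: "\<And>i. u i \<in> \<rat>" "u \<longlonglongrightarrow> t1" unfolding closure_sequential by blast
    have uJ: "\<forall>\<^sub>F i in sequentially. u i \<in> J" by (rule topological_tendstoD[OF u(2) J(1) t1(1)])
    have l1: "(\<lambda>i. \<phi> q (u i)) \<longlonglongrightarrow> ?y" by (rule isCont_tendsto_compose[OF contq[OF t1(1)] u(2)])
    have "(\<lambda>i. \<sigma> (u i)) \<longlonglongrightarrow> \<sigma> t1"
      using continuous_on_tendsto_compose[OF cont u(2)] t1 uJ by (simp add: J_def)
    then have l2: "(\<lambda>i. A *\<^sub>R \<sigma> (u i)) \<longlonglongrightarrow> A *\<^sub>R \<sigma> t1" by (intro tendsto_intros)
    have e1: "\<forall>\<^sub>F i in sequentially. \<phi> q (u i) \<in> ball ?y (r/2)"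
      using y by (intro topological_tendstoD[OF l1]) auto
    have e2: "\<forall>\<^sub>F i in sequentially. A *\<^sub>R \<sigma> (u i) \<in> ball 0 (r/2)"
      using sm by (intro topological_tendstoD[OF l2]) auto
    have "(\<lambda>i. case (\<phi> q (u i), A *\<^sub>R \<sigma> (u i)) of (z, w) \<Rightarrow> T n z w) \<longlonglongrightarrow>
        (case (?y, A *\<^sub>R \<sigma> t1) of (z, w) \<Rightarrow> T n z w)"
    proof (rule continuous_on_tendsto_compose[OF taylor_family_continuous[OF T] tendsto_Pair[OF l1 l2]])
      show "\<forall>\<^sub>F i in sequentially. (\<phi> q (u i), A *\<^sub>R \<sigma> (u i)) \<in> ball ?y (r/2) \<times> ball 0 (r/2)"
        using e1 e2 by eventually_elim auto
    qed (use y sm in auto)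
    then have "(\<lambda>i. T n (\<phi> q (u i)) (A *\<^sub>R \<sigma> (u i))) \<longlonglongrightarrow> T n ?y (A *\<^sub>R \<sigma> t1)" by simp
    moreover have "\<forall>\<^sub>F i in sequentially. T n (\<phi> q (u i)) (A *\<^sub>R \<sigma> (u i)) = 0"
      using uJ e1 e2 by eventually_elim (intro rat u(1))
    ultimately have "(\<lambda>i. 0) \<longlonglongrightarrow> T n ?y (A *\<^sub>R \<sigma> t1)"
      by (rule Lim_transform_eventually)
    then show ?thesis by (simp add: LIMSEQ_const_iff)
  qed
  with shift nonzero show False by simp
qed

section \<open>Nested construction on rational grid lines\<close>

text \<open>The Boolean lets the two families of lines alternate by parity: stage \<open>n\<close>
  fixes the coordinate \<open>even n\<close>, and negation gives the other one.\<close>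

definition coord :: "bool \<Rightarrow> real \<times> real \<Rightarrow> real" where
  "coord b p = (if b then fst p else snd p)"

lemma continuous_on_coord: "continuous_on S (coord b)"
  unfolding coord_def by (cases b) (auto intro!: continuous_intros)

lemma Rats_int_fraction:
  assumes "t \<in> \<rat>"
  obtains a b :: int where "b > 0" "of_int b * t = (of_int a :: real)"
proof -
  obtain a b :: int where "b > 0" "t = of_int a / of_int b"
    using assms by (elim Rats_cases') blast
  then show ?thesis by (intro that[of b a]) auto
qed

text \<open>For \<open>t\<close> between the heights of stages \<open>i\<close> and
  \<open>i + 1\<close> the line of stage \<open>i\<close> is used. Its error was made at most
  \<open>f m\<close> at the later height, which is at most \<open>f m t\<close> since
  \<open>f m\<close> is non-increasing; so no gap is left between consecutive heights.\<close>

lemma exists_uniform_nonvanishing_point: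
  fixes V :: "(real \<times> real) set" and h :: "nat \<Rightarrow> real \<times> real \<Rightarrow> real" and f :: "nat \<Rightarrow> real \<Rightarrow> real"
  assumes V: "open V" "V \<noteq> {}" and cont: "\<And>i. continuous_on V (h i)"
    and good: "\<And>i o' c \<epsilon>. c \<in> V \<Longrightarrow> \<epsilon> > 0 \<Longrightarrow> \<exists>t\<in>\<rat>. \<forall>\<delta>>0. \<exists>p\<in>V. dist p c < \<epsilon> \<and>
        coord (\<not> o') p = t \<and> \<bar>coord o' p - coord o' c\<bar> < \<delta> \<and> h i p \<noteq> 0"
    and pos: "\<And>m t. m \<ge> 1 \<Longrightarrow> t > 0 \<Longrightarrow> f m t > 0"
    and anti: "\<And>m. m \<ge> 1 \<Longrightarrow> antimono_on {0<..} (f m)"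
  obtains p where "p \<in> V" "\<And>i. h i p \<noteq> 0"
    "\<And>m. m \<ge> 1 \<Longrightarrow> \<forall>\<^sub>F t in at_top. \<exists>o' (a::int) (b::int). b > 0 \<and> of_int \<bar>a\<bar> \<le> t \<and> of_int b \<le> t \<and>
        \<bar>of_int b * coord o' p - of_int a\<bar> \<le> f m t"
proof -
  \<comment> \<open>A stage consists of a ball of centre \<open>c\<close> and radius \<rho>, the
    fraction a/b whose line passes through \<open>c\<close>, and a bound \<open>H\<close> for the
    height of that line.\<close>
  define P where "P n x \<longleftrightarrow> (case x of (c, \<rho>, a, b, H) \<Rightarrow> \<rho> > 0 \<and> cball c \<rho> \<subseteq> V \<and> b > 0 \<and>
      of_int b * coord (even n) c = of_int a \<and> \<bar>a\<bar> \<le> int H \<and> b \<le> int H)"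
    for n :: nat and x :: "(real \<times> real) \<times> real \<times> int \<times> int \<times> nat"
  \<comment> \<open>The range \<open>{1..Suc n}\<close> brings one more function under control at
    each stage: finitely many bounds are met at a time, and each \<open>f m\<close> is met from some
    stage on.\<close>
  define Q where "Q n x y \<longleftrightarrow> (case x of (c, \<rho>, a, b, H) \<Rightarrow> case y of (c', \<rho>', a', b', H') \<Rightarrow>
      cball c' \<rho>' \<subseteq> cball c \<rho> \<and> H < H' \<and>
      (\<forall>p\<in>cball c' \<rho>'. h n p \<noteq> 0 \<and>
         (\<forall>m\<in>{1..Suc n}. \<bar>of_int b * coord (even n) p - of_int a\<bar> \<le> f m (real H'))))"
    for n :: nat and x y :: "(real \<times> real) \<times> real \<times> int \<times> int \<times> nat"
  have start: "\<exists>x. P 0 x"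
  proof -
    obtain c0 where c0: "c0 \<in> V" using V by blast
    \<comment> \<open>Only a point of \<open>V\<close> with rational first coordinate is wanted
      here; \<open>False\<close> is passed because \<open>good\<close> makes the negated coordinate
      rational.\<close>
    obtain t where t: "t \<in> \<rat>" "\<forall>\<delta>>0. \<exists>p\<in>V. dist p c0 < 1 \<and>
        coord (\<not> False) p = t \<and> \<bar>coord False p - coord False c0\<bar> < \<delta> \<and> h 0 p \<noteq> 0"
      using good[OF c0, of 1 False 0] by auto
    obtain p where p: "p \<in> V" "coord True p = t" using t(2)[rule_format, of 1] by auto
    obtain a b :: int where ab: "b > 0" "of_int b * t = (of_int a :: real)" by (rule Rats_int_fraction[OF t(1)])
    obtain \<rho> where "\<rho> > 0" "cball p \<rho> \<subseteq> V" using V p open_contains_cball by blast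
    then have "P 0 (p, \<rho>, a, b, nat (max \<bar>a\<bar> b))" using ab p by (simp add: P_def)
    then show ?thesis by blast
  qed
  have step: "\<exists>y. P (Suc n) y \<and> Q n x y" if Px: "P n x" for n x
  proof -
    obtain c \<rho> a b H where x: "x = (c, \<rho>, a, b, H)" by (cases x)
    have c: "\<rho> > 0" "cball c \<rho> \<subseteq> V" "b > 0" "of_int b * coord (even n) c = of_int a"
        "\<bar>a\<bar> \<le> int H" "b \<le> int H"
      using Px by (auto simp: P_def x)
    have "c \<in> V" using c by auto
    then obtain t where t: "t \<in> \<rat>" "\<forall>\<delta>>0. \<exists>p\<in>V. dist p c < \<rho> \<and>
        coord (\<not> even n) p = t \<and> \<bar>coord (even n) p - coord (even n) c\<bar> < \<delta> \<and> h n p \<noteq> 0"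
      using good[of c \<rho> "even n" n] c by blast
    obtain a' b' :: int where ab: "b' > 0" "of_int b' * t = (of_int a' :: real)"
      by (rule Rats_int_fraction[OF t(1)])
    \<comment> \<open>\<open>Suc H\<close> forces strict growth even if the new fraction happens to
      have small height.\<close>
    define H' where "H' = max (Suc H) (nat (max \<bar>a'\<bar> b'))"
    have H': "H < H'" "\<bar>a'\<bar> \<le> int H'" "b' \<le> int H'" unfolding H'_def by auto
    \<comment> \<open>\<eta> depends on \<open>H'\<close> and hence on \<open>t\<close>. That
      \<open>good\<close> provides its \<open>t\<close> before \<delta> is used here: the point
      \<open>p\<close> on the same line is taken for \<delta> = \<eta> / b.\<close>
    define \<eta> where "\<eta> = Min ((\<lambda>m. f m (real H')) ` {1..Suc n})"
    have \<eta>: "\<eta> > 0" unfolding \<eta>_def using H' by (subst Min_gr_iff) (auto intro!: pos)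
    obtain p where p: "p \<in> V" "dist p c < \<rho>" "coord (\<not> even n) p = t"
        "\<bar>coord (even n) p - coord (even n) c\<bar> < \<eta> / of_int b" "h n p \<noteq> 0"
      using t(2)[rule_format, of "\<eta> / of_int b"] \<eta> c(3) by auto
    have "\<bar>of_int b * coord (even n) p - of_int a\<bar> = of_int b * \<bar>coord (even n) p - coord (even n) c\<bar>"
      using c(3) unfolding c(4)[symmetric] by (simp add: abs_mult flip: right_diff_distrib)
    also have "\<dots> < \<eta>" using p(4) c(3) by (simp add: field_simps)
    finally have small: "\<bar>of_int b * coord (even n) p - of_int a\<bar> < \<eta>" .
    define O' where "O' = (V \<inter> h n -` (- {0})) \<inter> {p. \<bar>of_int b * coord (even n) p - of_int a\<bar> < \<eta>} \<inter> ball c \<rho>"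
    have "open O'" unfolding O'_def
      by (intro open_Int continuous_open_preimage cont V open_Collect_less open_ball)
         (auto intro!: continuous_intros continuous_on_coord)
    moreover have "p \<in> O'" unfolding O'_def using p small by (auto simp: dist_commute)
    ultimately obtain \<rho>' where \<rho>': "\<rho>' > 0" "cball p \<rho>' \<subseteq> O'" using open_contains_cball by blast
    have "P (Suc n) (p, \<rho>', a', b', H')"
      unfolding P_def using \<rho>' H' ab p(3) by (auto simp: O'_def)
    moreover have "Q n x (p, \<rho>', a', b', H')"
    proof -
      have "\<eta> \<le> f m (real H')" if "m \<in> {1..Suc n}" for m
        unfolding \<eta>_def using that by (intro Min_le) auto
      moreover have "cball p \<rho>' \<subseteq> cball c \<rho>" using \<rho>'(2) unfolding O'_def by auto
      moreover have "h n p' \<noteq> 0 \<and> \<bar>of_int b * coord (even n) p' - of_int a\<bar> < \<eta>" if "p' \<in> cball p \<rho>'" for p'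
        using \<rho>'(2) that unfolding O'_def by auto
      ultimately have "cball p \<rho>' \<subseteq> cball c \<rho>" "\<forall>p'\<in>cball p \<rho>'. h n p' \<noteq> 0 \<and>
         (\<forall>m\<in>{1..Suc n}. \<bar>of_int b * coord (even n) p' - of_int a\<bar> \<le> f m (real H'))"
        by (blast, meson less_imp_le less_le_trans)
      then show ?thesis unfolding Q_def x using H'(1) by simp
    qed
    ultimately show ?thesis by blast
  qed
  obtain F where F: "\<And>n. P n (F n)" "\<And>n. Q n (F n) (F (Suc n))"
    using dependent_nat_choice[of P Q, OF start step] by blast
  define c where "c n = fst (F n)" for n
  define \<rho> where "\<rho> n = fst (snd (F n))" for n
  define a where "a n = fst (snd (snd (F n)))" for n
  define b where "b n = fst (snd (snd (snd (F n))))" for n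
  define H where "H n = snd (snd (snd (snd (F n))))" for n
  have Fn: "F n = (c n, \<rho> n, a n, b n, H n)" for n by (simp add: c_def \<rho>_def a_def b_def H_def)
  have P: "\<rho> n > 0" "cball (c n) (\<rho> n) \<subseteq> V" "b n > 0" "\<bar>a n\<bar> \<le> int (H n)" "b n \<le> int (H n)" for n
    using F(1)[of n] unfolding P_def Fn by auto
  have Q: "cball (c (Suc n)) (\<rho> (Suc n)) \<subseteq> cball (c n) (\<rho> n)" "H n < H (Suc n)"
      "p \<in> cball (c (Suc n)) (\<rho> (Suc n)) \<Longrightarrow> h n p \<noteq> 0"
      "p \<in> cball (c (Suc n)) (\<rho> (Suc n)) \<Longrightarrow> m \<in> {1..Suc n} \<Longrightarrow>
        \<bar>of_int (b n) * coord (even n) p - of_int (a n)\<bar> \<le> f m (real (H (Suc n)))" for n m p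
    using F(2)[of n] unfolding Q_def Fn by auto
  have "\<Inter>(range (\<lambda>n. cball (c n) (\<rho> n))) \<noteq> {}"
  proof (rule compact_nest)
    show "cball (c m) (\<rho> m) \<noteq> {}" for m using P(1)[of m] by (simp add: less_imp_le)
    show "cball (c n) (\<rho> n) \<subseteq> cball (c m) (\<rho> m)" if "m \<le> n" for m n
      by (rule lift_Suc_antimono_le[of "\<lambda>n. cball (c n) (\<rho> n)", OF Q(1) that])
  qed auto
  then obtain p where "p \<in> \<Inter>(range (\<lambda>n. cball (c n) (\<rho> n)))" by blast
  then have p: "p \<in> cball (c n) (\<rho> n)" for n by blast
  have Hmono: "strict_mono H" using Q(2) by (simp add: strict_mono_Suc_iff)
  show ?thesis
  proof (rule that[of p])
    show "p \<in> V" using p P(2) by blast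
    show "h i p \<noteq> 0" for i using Q(3)[OF p] .
    fix m :: nat assume m: "m \<ge> 1"
    show "\<forall>\<^sub>F t in at_top. \<exists>o' (a::int) (b::int). b > 0 \<and> of_int \<bar>a\<bar> \<le> t \<and> of_int b \<le> t \<and>
        \<bar>of_int b * coord o' p - of_int a\<bar> \<le> f m t"
      using eventually_ge_at_top[of "real (H m)"]
    proof eventually_elim
      case (elim t)
      have "\<exists>j. t < real (H j)"
      proof -
        obtain j where "t < real j" using reals_Archimedean2 by blast
        then have "t < real (H j)" using strict_mono_imp_increasing[OF Hmono, of j] by linarith
        then show ?thesis by blast
      qed
      \<comment> \<open>As \<open>t\<close> is at least \<open>H m\<close>, this index exceeds
        \<open>m\<close>, so its predecessor \<open>i\<close> satisfies m \<le> i and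
        \<open>f m\<close> is among the functions controlled at stage \<open>i\<close>.\<close>
      define j where "j = (LEAST j. t < real (H j))"
      have j: "t < real (H j)" unfolding j_def by (rule LeastI_ex) fact
      have "\<not> j \<le> m" using elim j strict_mono_less_eq[OF Hmono, of j m] by linarith
      then obtain i where i: "j = Suc i" "m \<le> i" by (cases j) auto
      have "\<not> t < real (H i)" using not_less_Least[of i "\<lambda>j. t < real (H j)"] i unfolding j_def by simp
      then have t: "real (H i) \<le> t" "t \<le> real (H (Suc i))" using j i by auto
      have "b i > 0" "of_int \<bar>a i\<bar> \<le> t" "of_int (b i) \<le> t" using P(3-5)[of i] t by linarith+
      moreover have "\<bar>of_int (b i) * coord (even i) p - of_int (a i)\<bar> \<le> f m (real (H (Suc i)))"
        by (rule Q(4)[OF p]) (use m i in auto)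
      moreover have "f m (real (H (Suc i))) \<le> f m t"
        by (rule monotone_onD[OF anti[OF m]]) (use t P(3,5)[of i] in auto)
      ultimately show ?case by (meson order_trans)
    qed
  qed
qed

section \<open>Linear forms over the integers\<close>

lemma linear_int_mpoly:
  fixes j :: "'n::finite" and a b :: int
  assumes "b > 0"
  obtains P :: "'n int_mpoly" where "P \<noteq> 0" "mpoly_degree P \<le> 1"
    "mpoly_height P \<le> max \<bar>a\<bar> b" "\<And>x. mpoly_eval P x = of_int b * x $ j - of_int a"
proof -
  define e where "e = Poly_Mapping.single j (1::nat)"
  define P where "P = Poly_Mapping.single e b + Poly_Mapping.single 0 (- a)"
  have e0: "e \<noteq> 0" unfolding e_def by (metis lookup_single_eq lookup_zero zero_neq_one)
  have lk: "Poly_Mapping.lookup P m = (if m = e then b else if m = 0 then - a else 0)" for m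
    using e0 by (auto simp: P_def lookup_add lookup_single when_def)
  have keys: "Poly_Mapping.keys P \<subseteq> {e, 0}" by (auto simp: in_keys_iff lk split: if_splits)
  have sume: "(\<Sum>i\<in>UNIV. Poly_Mapping.lookup e i) = 1"
    by (simp add: e_def lookup_single when_def)
  show ?thesis
  proof (rule that)
    show "P \<noteq> 0" using lk[of e] assms by auto
    show "mpoly_degree P \<le> 1"
      unfolding mpoly_degree_def using keys sume
      by (subst Max_le_iff) (auto dest!: subsetD)
    show "mpoly_height P \<le> max \<bar>a\<bar> b"
      unfolding mpoly_height_def using assms by (subst Max_le_iff) (auto simp: lk)
    fix x :: "real ^ 'n"
    have "mpoly_eval P x = (\<Sum>m\<in>{e, 0}. of_int (Poly_Mapping.lookup P m) * monom_eval m x)"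
      unfolding mpoly_eval_def by (rule sum.mono_neutral_left) (use keys in \<open>auto simp: in_keys_iff\<close>)
    also have "\<dots> = of_int b * monom_eval e x - of_int a * monom_eval 0 x"
      using e0 by (simp add: lk)
    also have "monom_eval e x = x $ j"
    proof -
      have "monom_eval e x = (\<Prod>i\<in>UNIV. if i = j then x $ i else 1)"
        unfolding monom_eval_def by (intro prod.cong) (auto simp: e_def lookup_single when_def)
      then show ?thesis by simp
    qed
    finally show "mpoly_eval P x = of_int b * x $ j - of_int a" by (simp add: monom_eval_def)
  qed
qed

lemma f_uniform_if_near_rational_hyperplanes:
  fixes x :: "real ^ 'n::finite"
  assumes "\<forall>\<^sub>F t in at_top. \<exists>j (a::int) (b::int). b > 0 \<and> of_int \<bar>a\<bar> \<le> t \<and> of_int b \<le> t \<and>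
        \<bar>of_int b * x $ j - of_int a\<bar> \<le> f t" and "k \<ge> 1"
  shows "f_uniform f k x"
  unfolding f_uniform_def using assms(1)
proof eventually_elim
  case (elim t)
  then obtain j and a b :: int where j: "b > 0" "of_int \<bar>a\<bar> \<le> t" "of_int b \<le> t"
    "\<bar>of_int b * x $ j - of_int a\<bar> \<le> f t" by blast
  obtain P :: "'n int_mpoly" where P: "P \<noteq> 0" "mpoly_degree P \<le> 1"
    "mpoly_height P \<le> max \<bar>a\<bar> b" "\<And>x. mpoly_eval P x = of_int b * x $ j - of_int a"
    using linear_int_mpoly[OF j(1)] by blast
  have "of_int (mpoly_height P) \<le> (of_int (max \<bar>a\<bar> b) :: real)" using P(3) by (simp only: of_int_le_iff)
  also have "\<dots> \<le> t" using j by (simp add: max_def)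
  finally show ?case using P j assms(2) by (intro exI[of _ P]) auto
qed

section \<open>Plane coordinates from the inverse function theorem\<close>

lemma linear_plane_inverse:
  fixes L :: "real \<times> real \<Rightarrow> real \<times> real"
  assumes L: "linear L"
  defines "\<Delta> \<equiv> fst (L (1,0)) * snd (L (0,1)) - fst (L (0,1)) * snd (L (1,0))"
  defines "M \<equiv> \<lambda>v. ((snd (L (0,1)) * fst v - fst (L (0,1)) * snd v) / \<Delta>,
                      (fst (L (1,0)) * snd v - snd (L (1,0)) * fst v) / \<Delta>)"
  shows "\<Delta> \<noteq> 0 \<Longrightarrow> M (L v) = v" and "bij L \<Longrightarrow> \<Delta> \<noteq> 0" and "bij L \<Longrightarrow> inv L = M"
proof -
  obtain a c where ac: "L (1,0) = (a, c)" by fastforce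
  obtain b d where bd: "L (0,1) = (b, d)" by fastforce
  have L_eq: "L (x, y) = (a * x + b * y, c * x + d * y)" for x y
  proof -
    have "L (x, y) = L (x *\<^sub>R (1,0) + y *\<^sub>R (0,1))" by simp
    also have "\<dots> = x *\<^sub>R L (1,0) + y *\<^sub>R L (0,1)"
      by (simp only: linear_add[OF L] linear_scale[OF L])
    finally show ?thesis by (simp add: ac bd mult.commute)
  qed
  have \<Delta>: "\<Delta> = a * d - b * c" by (simp add: \<Delta>_def ac bd)
  have M: "M (x, y) = ((d * x - b * y) / (a * d - b * c), (a * y - c * x) / (a * d - b * c))" for x y
    by (simp add: M_def \<Delta> ac bd)
  show inv1: "M (L v) = v" if "\<Delta> \<noteq> 0" for v
    using that by (cases v) (simp add: L_eq M \<Delta> divide_simps, simp add: algebra_simps)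
  show nz: "\<Delta> \<noteq> 0" if "bij L"
  proof
    assume "\<Delta> = 0"
    then have 0: "a * d = b * c" by (simp add: \<Delta>)
    have inj: "L v = 0 \<Longrightarrow> v = 0" for v
      using bij_is_inj[OF that] linear_injective_0[OF L] by blast
    \<comment> \<open>When the determinant is zero the columns of the adjugate lie in the kernel, so
      injectivity makes all four entries vanish.\<close>
    have "(d, - c) = 0" by (rule inj) (simp add: L_eq 0 zero_prod_def)
    moreover have "(- b, a) = 0" by (rule inj) (simp add: L_eq 0 zero_prod_def mult.commute)
    ultimately have "L (1, 0) = 0" by (simp add: L_eq zero_prod_def)
    then show False using inj[of "(1,0)"] by (simp add: zero_prod_def)
  qed
  show "inv L = M" if "bij L"
  proof
    fix v
    have "M (L (inv L v)) = inv L v" by (rule inv1[OF nz[OF that]])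
    then show "inv L v = M v" using bij_is_surj[OF that] by (simp add: surj_f_inv_f)
  qed
qed

text \<open>The clause on \<open>h\<close> is quantified after \<open>V\<close> and
  \<open>g\<close>, so that one chart serves countably many functions at once. It results from
  applying \<open>good_rational_line\<close> to the curves that \<open>g\<close> makes of the
  coordinate lines.\<close>

lemma rational_grid_coordinates:
  fixes F1 F2 :: "real \<times> real \<Rightarrow> real"
  assumes U: "open U" "x0 \<in> U" and an: "line_analytic_at F1 x0" "line_analytic_at F2 x0"
    and D1: "(F1 has_derivative D1) (at x0)" and D2: "(F2 has_derivative D2) (at x0)"
    and det: "D1 (1,0) * D2 (0,1) - D1 (0,1) * D2 (1,0) \<noteq> 0"
  obtains V g where "open V" "V \<noteq> {}" "g ` V \<subseteq> U" "continuous_on V g"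
    "\<And>p. p \<in> V \<Longrightarrow> F1 (g p) = fst p" "\<And>p. p \<in> V \<Longrightarrow> F2 (g p) = snd p"
    "\<And>h o' c \<epsilon>. \<forall>x\<in>U. line_analytic_at h x \<and> \<not> (\<forall>\<^sub>F y in nhds x. h y = 0) \<Longrightarrow> c \<in> V \<Longrightarrow> \<epsilon> > 0 \<Longrightarrow>
       \<exists>t\<in>\<rat>. \<forall>\<delta>>0. \<exists>p\<in>V. dist p c < \<epsilon> \<and>
        coord (\<not> o') p = t \<and> \<bar>coord o' p - coord o' c\<bar> < \<delta> \<and> h (g p) \<noteq> 0"
proof -
  obtain r1 E1 where E1: "r1 > 0" "\<And>z. z \<in> ball x0 r1 \<Longrightarrow> (F1 has_derivative E1 z) (at z)"
    "\<And>v. continuous_on (ball x0 r1) (\<lambda>z. E1 z v)"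
    using line_analytic_has_derivative[OF an(1)] by blast
  obtain r2 E2 where E2: "r2 > 0" "\<And>z. z \<in> ball x0 r2 \<Longrightarrow> (F2 has_derivative E2 z) (at z)"
    "\<And>v. continuous_on (ball x0 r2) (\<lambda>z. E2 z v)"
    using line_analytic_has_derivative[OF an(2)] by blast
  define U0 where "U0 = U \<inter> ball x0 r1 \<inter> ball x0 r2"
  have U0: "open U0" "x0 \<in> U0" using U E1 E2 by (auto simp: U0_def)
  define F where "F x = (F1 x, F2 x)" for x
  define F' where "F' x = Blinfun (\<lambda>v. (E1 x v, E2 x v))" for x
  have der: "(F has_derivative (\<lambda>v. (E1 x v, E2 x v))) (at x)" if "x \<in> U0" for x
    unfolding F_def using E1(2)[of x] E2(2)[of x] that by (intro has_derivative_Pair) (auto simp: U0_def)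
  have F': "blinfun_apply (F' x) = (\<lambda>v. (E1 x v, E2 x v))" if "x \<in> U0" for x
    unfolding F'_def using has_derivative_bounded_linear[OF der[OF that]] by (rule bounded_linear_Blinfun_apply)
  have E0: "E1 x0 = D1" "E2 x0 = D2"
    using has_derivative_unique[OF D1 E1(2)] has_derivative_unique[OF D2 E2(2)] E1 E2 by auto
  have contE: "continuous_on U0 (\<lambda>x. E1 x v)" "continuous_on U0 (\<lambda>x. E2 x v)" for v
    by (rule continuous_on_subset[OF E1(3)] continuous_on_subset[OF E2(3)]; auto simp: U0_def)+
  have contF': "continuous_on U0 F'"
  proof (rule continuous_on_blinfun_componentwise)
    fix i :: "real \<times> real"
    have "continuous_on U0 (\<lambda>x. (E1 x i, E2 x i))" by (intro continuous_intros contE)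
    then show "continuous_on U0 (\<lambda>x. blinfun_apply (F' x) i)"
      by (rule continuous_on_eq) (simp add: F')
  qed
  let ?L = "blinfun_apply (F' x0)"
  have linL: "linear ?L" by (rule bounded_linear.linear[OF blinfun.bounded_linear_right])
  \<comment> \<open>Cramer's rule at \<open>x0\<close>, to supply the left inverse of the derivative
    as a bounded linear map.\<close>
  define N where "N v = ((snd (?L (0,1)) * fst v - fst (?L (0,1)) * snd v) /
        (fst (?L (1,0)) * snd (?L (0,1)) - fst (?L (0,1)) * snd (?L (1,0))),
      (fst (?L (1,0)) * snd v - snd (?L (1,0)) * fst v) /
        (fst (?L (1,0)) * snd (?L (0,1)) - fst (?L (0,1)) * snd (?L (1,0))))" for v
  have NL: "N (?L v) = v" for v
    unfolding N_def by (rule linear_plane_inverse(1)[OF linL]) (use det in \<open>simp add: F'[OF U0(2)] E0\<close>)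
  have "linear N" unfolding N_def
    by (rule linearI) (auto simp: add_divide_distrib diff_divide_distrib algebra_simps)
  then have "bounded_linear N" by (simp add: linear_conv_bounded_linear)
  then have invM: "Blinfun N o\<^sub>L F' x0 = id_blinfun"
    by (intro blinfun_eqI) (simp add: bounded_linear_Blinfun_apply NL)
  have "\<exists>U' V g g'. (open U' \<and> U' \<subseteq> U0 \<and> x0 \<in> U' \<and> open V \<and> F x0 \<in> V \<and> homeomorphism U' V F g) \<and>
    (\<forall>y\<in>V. (g has_derivative (g' y)) (at y) \<and> g' y = inv (blinfun_apply (F' (g y))) \<and>
      bij (blinfun_apply (F' (g y))))"
  proof (rule inverse_function_theorem[OF U0(1) _ contF' U0(2) invM, of F])
    show "(F has_derivative blinfun_apply (F' x)) (at x)" if "x \<in> U0" for x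
      using der[OF that] F'[OF that] by simp
    fix U' V g g'
    assume "open U'" "U' \<subseteq> U0" "x0 \<in> U'" "open V" "F x0 \<in> V" "homeomorphism U' V F g"
      and "\<And>y. y \<in> V \<Longrightarrow> (g has_derivative (g' y)) (at y)"
        "\<And>y. y \<in> V \<Longrightarrow> g' y = inv (blinfun_apply (F' (g y)))"
        "\<And>y. y \<in> V \<Longrightarrow> bij (blinfun_apply (F' (g y)))"
    then show ?thesis by (intro exI[of _ U'] exI[of _ V] exI[of _ g] exI[of _ g']) simp
  qed
  then obtain U' V g g'
    where "(open U' \<and> U' \<subseteq> U0 \<and> x0 \<in> U' \<and> open V \<and> F x0 \<in> V \<and> homeomorphism U' V F g) \<and>
    (\<forall>y\<in>V. (g has_derivative (g' y)) (at y) \<and> g' y = inv (blinfun_apply (F' (g y))) \<and>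
      bij (blinfun_apply (F' (g y))))"
    by (elim exE)
  then have inv: "open U'" "U' \<subseteq> U0" "x0 \<in> U'" "open V" "F x0 \<in> V" "homeomorphism U' V F g"
    and g': "\<And>y. y \<in> V \<Longrightarrow> (g has_derivative (g' y)) (at y)"
      "\<And>y. y \<in> V \<Longrightarrow> g' y = inv (blinfun_apply (F' (g y)))"
      "\<And>y. y \<in> V \<Longrightarrow> bij (blinfun_apply (F' (g y)))"
    by blast+
  have gV: "g y \<in> U'" "g y \<in> U0" "g y \<in> U" "F (g y) = y" if "y \<in> V" for y
    using that inv(2,6) by (auto simp: homeomorphism_def U0_def)
  have contg: "continuous_on V g" using inv(6) by (simp add: homeomorphism_def)
  have surj: "\<exists>v. w = g' y v" if "y \<in> V" for y w
    using g'(2,3)[OF that] bij_imp_bij_inv bij_is_surj surjD by metis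
  \<comment> \<open>Cramer's rule expresses the inverse of \<open>F' (g y)\<close> as a quotient of
    functions continuous in \<open>y\<close>; \<open>good_rational_line\<close> needs this for its
    transversal derivative.\<close>
  have contg': "continuous_on V (\<lambda>y. g' y v)" for v
  proof -
    let ?d = "\<lambda>y. E1 (g y) (1,0) * E2 (g y) (0,1) - E1 (g y) (0,1) * E2 (g y) (1,0)"
    have eq: "?d y \<noteq> 0" "g' y v = ((E2 (g y) (0,1) * fst v - E1 (g y) (0,1) * snd v) / ?d y,
          (E1 (g y) (1,0) * snd v - E2 (g y) (1,0) * fst v) / ?d y)" if y: "y \<in> V" for y
    proof -
      have lin: "linear (blinfun_apply (F' (g y)))" by (rule bounded_linear.linear[OF blinfun.bounded_linear_right])
      note F'y = F'[OF gV(2)[OF y]]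
      show "?d y \<noteq> 0" using linear_plane_inverse(2)[OF lin g'(3)[OF y]] by (simp add: F'y)
      show "g' y v = ((E2 (g y) (0,1) * fst v - E1 (g y) (0,1) * snd v) / ?d y,
          (E1 (g y) (1,0) * snd v - E2 (g y) (1,0) * fst v) / ?d y)"
        using linear_plane_inverse(3)[OF lin g'(3)[OF y]] g'(2)[OF y] by (simp add: F'y)
    qed
    have "continuous_on V (\<lambda>y. E1 (g y) u)" "continuous_on V (\<lambda>y. E2 (g y) u)" for u
      by (rule continuous_on_compose2[OF contE(1) contg] continuous_on_compose2[OF contE(2) contg];
          use gV(2) in blast)+
    then have "continuous_on V (\<lambda>y. ((E2 (g y) (0,1) * fst v - E1 (g y) (0,1) * snd v) / ?d y,
          (E1 (g y) (1,0) * snd v - E2 (g y) (1,0) * fst v) / ?d y))"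
      using eq(1) by (intro continuous_intros) auto
    then show ?thesis by (rule continuous_on_eq) (simp add: eq(2))
  qed
  show ?thesis
  proof (rule that[of V g])
    show "open V" "V \<noteq> {}" "continuous_on V g" using inv contg by auto
    show "g ` V \<subseteq> U" using gV by auto
    show "F1 (g p) = fst p" "F2 (g p) = snd p" if "p \<in> V" for p
      using gV(4)[OF that] by (metis F_def fst_conv, metis F_def snd_conv)
    fix h o' c and \<epsilon> :: real
    assume h: "\<forall>x\<in>U. line_analytic_at h x \<and> \<not> (\<forall>\<^sub>F y in nhds x. h y = 0)" and c: "c \<in> V" and "\<epsilon> > 0"
    obtain \<epsilon>1 where \<epsilon>1: "\<epsilon>1 > 0" "ball c \<epsilon>1 \<subseteq> V" using inv(4) c open_contains_ball by blast
    \<comment> \<open>Halved because the distance to \<open>c\<close> is estimated by the sum of the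
      two coordinate deviations.\<close>
    define e where "e = min \<epsilon> \<epsilon>1 / 2"
    have e: "e > 0" "e + e \<le> \<epsilon>" "e + e \<le> \<epsilon>1" using \<open>\<epsilon> > 0\<close> \<epsilon>1 by (auto simp: e_def min_def)
    \<comment> \<open>\<open>s\<close> is the coordinate held at \<open>q\<close> by the old line,
      \<open>t\<close> the one to be made rational; the swap lets one argument treat both
      directions.\<close>
    define mk where "mk s t = (if o' then (s, t) else (t, s))" for s t :: real
    define q where "q = coord o' c"
    define t0 where "t0 = coord (\<not> o') c"
    have mk: "coord o' (mk s t) = s" "coord (\<not> o') (mk s t) = t" "mk q t0 = c" for s t
      by (auto simp: mk_def coord_def q_def t0_def)
    have dmk: "dist (mk s t) c < e + e" if "\<bar>s - q\<bar> < e" "\<bar>t - t0\<bar> < e" for s t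
    proof -
      have "dist (mk s t) c \<le> \<bar>s - q\<bar> + \<bar>t - t0\<bar>"
        using sqrt_sum_squares_le_sum_abs[of "s - q" "t - t0"] sqrt_sum_squares_le_sum_abs[of "t - t0" "s - q"]
        by (cases c; cases o') (auto simp: mk_def q_def t0_def coord_def dist_Pair_Pair dist_real_def)
      then show ?thesis using that by linarith
    qed
    then have mkV: "mk s t \<in> V" if "\<bar>s - q\<bar> < e" "\<bar>t - t0\<bar> < e" for s t
      using that e(3) \<epsilon>1(2) by (force simp: dist_commute)
    have mkq: "mk q t \<in> V" if "\<bar>t - t0\<bar> < e" for t using mkV[of q t] that e(1) by simp
    have "\<exists>t\<in>\<rat>. \<bar>t - t0\<bar> < e \<and> (\<exists>\<^sub>F s in nhds q. h (g (mk s t)) \<noteq> 0)"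
    proof (rule good_rational_line[where \<phi> = "\<lambda>s t. g (mk s t)" and
          \<sigma> = "\<lambda>t. g' (mk q t) (mk 1 0)" and \<tau> = "\<lambda>t. g' (mk q t) (mk 0 1)"])
      fix t assume t: "\<bar>t - t0\<bar> < e"
      note g't = g'(1)[OF mkq[OF t]]
      have "((\<lambda>s. mk s t) has_derivative (\<lambda>s. s *\<^sub>R mk 1 0)) (at q)"
        by (cases o') (auto simp: mk_def intro!: derivative_eq_intros)
      from has_derivative_compose[OF this g't]
      show "((\<lambda>s. g (mk s t)) has_vector_derivative g' (mk q t) (mk 1 0)) (at q)"
        unfolding has_vector_derivative_def
        by (simp add: linear_scale[OF has_derivative_linear[OF g't]])
      have "(mk q has_derivative (\<lambda>s. s *\<^sub>R mk 0 1)) (at t)"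
        by (cases o') (auto simp: mk_def[abs_def] intro!: derivative_eq_intros)
      from has_derivative_compose[OF this g't]
      show "((\<lambda>t. g (mk q t)) has_vector_derivative g' (mk q t) (mk 0 1)) (at t)"
        unfolding has_vector_derivative_def
        by (simp add: linear_scale[OF has_derivative_linear[OF g't]])
      show "line_analytic_at h (g (mk q t))" "\<not> (\<forall>\<^sub>F x in nhds (g (mk q t)). h x = 0)"
        using h gV(3)[OF mkq[OF t]] by auto
      fix w
      obtain v where v: "w = g' (mk q t) v" using surj[OF mkq[OF t]] by blast
      have "v = coord o' v *\<^sub>R mk 1 0 + coord (\<not> o') v *\<^sub>R mk 0 1"
        by (cases v; cases o') (auto simp: mk_def coord_def)
      then have "w = coord o' v *\<^sub>R g' (mk q t) (mk 1 0) + coord (\<not> o') v *\<^sub>R g' (mk q t) (mk 0 1)"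
        unfolding v using linear_add[OF has_derivative_linear[OF g't]] linear_scale[OF has_derivative_linear[OF g't]]
        by metis
      then show "\<exists>a b. w = a *\<^sub>R g' (mk q t) (mk 1 0) + b *\<^sub>R g' (mk q t) (mk 0 1)" by blast
    next
      have "continuous_on {t. \<bar>t - t0\<bar> < e} (mk q)"
        by (cases o') (auto simp: mk_def[abs_def] intro!: continuous_intros)
      then show "continuous_on {t. \<bar>t - t0\<bar> < e} (\<lambda>t. g' (mk q t) (mk 1 0))"
        by (rule continuous_on_compose2[OF contg']) (use mkq in auto)
    qed (use e in auto)
    then obtain t where t: "t \<in> \<rat>" "\<bar>t - t0\<bar> < e" "\<exists>\<^sub>F s in nhds q. h (g (mk s t)) \<noteq> 0" by blast
    show "\<exists>t\<in>\<rat>. \<forall>\<delta>>0. \<exists>p\<in>V. dist p c < \<epsilon> \<and>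
        coord (\<not> o') p = t \<and> \<bar>coord o' p - coord o' c\<bar> < \<delta> \<and> h (g p) \<noteq> 0"
    proof (intro bexI[of _ t] allI impI)
      fix \<delta> :: real assume "\<delta> > 0"
      have "\<forall>\<^sub>F s in nhds q. s \<in> ball q (min \<delta> e)"
        by (rule eventually_nhds_in_open) (use \<open>\<delta> > 0\<close> e in auto)
      with t(3) have "\<exists>\<^sub>F s in nhds q. h (g (mk s t)) \<noteq> 0 \<and> s \<in> ball q (min \<delta> e)"
        by (simp add: frequently_eventually_frequently)
      then obtain s where s: "h (g (mk s t)) \<noteq> 0" "\<bar>s - q\<bar> < \<delta>" "\<bar>s - q\<bar> < e"
        by (auto dest!: frequently_ex simp: dist_real_def abs_minus_commute)
      show "\<exists>p\<in>V. dist p c < \<epsilon> \<and>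
        coord (\<not> o') p = t \<and> \<bar>coord o' p - coord o' c\<bar> < \<delta> \<and> h (g p) \<noteq> 0"
        using mkV[OF s(3) t(2)] dmk[OF s(3) t(2)] e s by (intro bexI[of _ "mk s t"]) (auto simp: mk q_def[symmetric])
    qed (rule t(1))
  qed
qed

section \<open>Slice charts\<close>

definition locally_zero_on :: "(real ^ 'n::finite) set \<Rightarrow> 'n int_mpoly \<Rightarrow> real ^ 'n \<Rightarrow> bool" where
  "locally_zero_on Y Q y \<longleftrightarrow> (\<forall>\<^sub>F x in nhds y. x \<in> Y \<longrightarrow> mpoly_eval Q x = 0)"

locale slice_chart =
  fixes Y V W :: "(real ^ 'n::finite) set" and \<Phi> \<Psi> :: "real ^ 'n \<Rightarrow> real ^ 'n" and I :: "'n set"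
  assumes open_V: "open V" and open_W: "open W" and homeo: "homeomorphism V W \<Phi> \<Psi>"
    and analytic_\<Phi>: "real_analytic_on \<Phi> V" and analytic_\<Psi>: "real_analytic_on \<Psi> W"
    and slice: "\<Phi> ` (Y \<inter> V) = W \<inter> {z. \<forall>i. i \<notin> I \<longrightarrow> z $ i = 0}"
begin

text \<open>Precomposing \<Psi> with this projection extends the parametrisation of the slice to an
  open subset of the full space. Results about analytic functions on open sets then apply with no
  change of dimension.\<close>

definition proj :: "real ^ 'n \<Rightarrow> real ^ 'n" where
  "proj z = (\<chi> i. if i \<in> I then z $ i else 0)"

lemma linear_proj: "linear proj"
  by (rule linearI) (auto simp: proj_def vec_eq_iff)

lemma bounded_linear_proj: "bounded_linear proj"
  using linear_proj by (simp add: linear_conv_bounded_linear)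

lemma proj_proj [simp]: "proj (proj z) = proj z"
  by (simp add: proj_def vec_eq_iff)

lemma proj_eq_iff: "proj z = z \<longleftrightarrow> (\<forall>i. i \<notin> I \<longrightarrow> z $ i = 0)"
  by (auto simp: proj_def vec_eq_iff)

lemma \<Psi>_slice:
  assumes "z \<in> W" "proj z = z"
  shows "\<Psi> z \<in> Y" "\<Psi> z \<in> V" "\<Phi> (\<Psi> z) = z"
proof -
  have "z \<in> \<Phi> ` (Y \<inter> V)" unfolding slice using assms by (simp add: proj_eq_iff)
  then obtain y where "y \<in> Y" "y \<in> V" "z = \<Phi> y" by blast
  then show "\<Psi> z \<in> Y" "\<Psi> z \<in> V" "\<Phi> (\<Psi> z) = z" using homeo by (auto simp: homeomorphism_def)
qed

lemma \<Phi>_slice: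
  assumes "y \<in> Y" "y \<in> V"
  shows "\<Phi> y \<in> W" "proj (\<Phi> y) = \<Phi> y" "\<Psi> (\<Phi> y) = y"
proof -
  have "\<Phi> y \<in> \<Phi> ` (Y \<inter> V)" using assms by blast
  then show "\<Phi> y \<in> W" "proj (\<Phi> y) = \<Phi> y" unfolding slice proj_eq_iff by auto
  show "\<Psi> (\<Phi> y) = y" using homeo assms by (auto simp: homeomorphism_def)
qed

lemma continuous_on_proj: "continuous_on S proj"
  by (rule linear_continuous_on[OF bounded_linear_proj])

lemma open_proj_vimage: "open S \<Longrightarrow> open (proj -` S)"
  using continuous_on_proj by (rule open_vimage[rotated])

lemma continuous_on_\<Psi>_proj: "continuous_on (proj -` W) (\<lambda>z. \<Psi> (proj z))"
  by (rule continuous_on_compose2[of W \<Psi>]) (use homeo continuous_on_proj in \<open>auto simp: homeomorphism_def\<close>)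

lemma line_analytic_component:
  assumes "proj z \<in> W"
  shows "line_analytic_at (\<lambda>z. \<Psi> (proj z) $ i) z"
proof -
  have "line_analytic_at (\<lambda>z. \<Psi> z $ i) (proj z + 0)"
    using real_analytic_on_imp_line_analytic[OF analytic_\<Psi> assms] by simp
  from line_analytic_at_compose_affine[OF this bounded_linear_proj] show ?thesis by simp
qed

lemma line_analytic_mpoly:
  assumes "proj z \<in> W"
  shows "line_analytic_at (\<lambda>z. mpoly_eval Q (\<Psi> (proj z))) z"
  by (rule line_analytic_at_mpoly_eval[of "\<lambda>z. \<Psi> (proj z)"]) (rule line_analytic_component[OF assms])

text \<open>Continuity of \<Phi> and of \<Psi> after projection moves neighbourhoods back and forth.
  Vanishing relative to \<open>Y\<close> becomes vanishing on an open set, where the identity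
  theorem is available.\<close>

lemma locally_zero_iff:
  assumes z: "z \<in> W" "proj z = z"
  shows "locally_zero_on Y Q (\<Psi> z) \<longleftrightarrow> (\<forall>\<^sub>F w in nhds z. mpoly_eval Q (\<Psi> (proj w)) = 0)"
proof
  have zW: "z \<in> proj -` W" using z by simp
  have ev: "\<forall>\<^sub>F w in nhds z. w \<in> proj -` W"
    by (rule eventually_nhds_in_open[OF open_proj_vimage[OF open_W] zW])
  have "isCont (\<lambda>z. \<Psi> (proj z)) z"
    using continuous_on_\<Psi>_proj zW continuous_on_eq_continuous_at[OF open_proj_vimage[OF open_W]] by blast
  then have lim: "((\<lambda>z. \<Psi> (proj z)) \<longlongrightarrow> \<Psi> z) (nhds z)"
    using z(2) tendsto_at_iff_tendsto_nhds[of "\<lambda>z. \<Psi> (proj z)" z] by (simp add: isCont_def)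
  assume "locally_zero_on Y Q (\<Psi> z)"
  then have "\<forall>\<^sub>F w in nhds z. \<Psi> (proj w) \<in> Y \<longrightarrow> mpoly_eval Q (\<Psi> (proj w)) = 0"
    unfolding locally_zero_on_def using lim by (rule eventually_compose_filterlim)
  then show "\<forall>\<^sub>F w in nhds z. mpoly_eval Q (\<Psi> (proj w)) = 0"
    using ev by eventually_elim (auto dest: \<Psi>_slice)
next
  assume zero: "\<forall>\<^sub>F w in nhds z. mpoly_eval Q (\<Psi> (proj w)) = 0"
  note y = \<Psi>_slice[OF z]
  have ev: "\<forall>\<^sub>F x in nhds (\<Psi> z). x \<in> V" by (rule eventually_nhds_in_open[OF open_V y(2)])
  have "isCont \<Phi> (\<Psi> z)"
    using homeo y(2) continuous_on_eq_continuous_at[OF open_V] by (auto simp: homeomorphism_def)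
  then have lim: "(\<Phi> \<longlongrightarrow> z) (nhds (\<Psi> z))"
    using y(3) tendsto_at_iff_tendsto_nhds[of \<Phi> "\<Psi> z"] by (simp add: isCont_def)
  have "\<forall>\<^sub>F x in nhds (\<Psi> z). mpoly_eval Q (\<Psi> (proj (\<Phi> x))) = 0"
    using zero lim by (rule eventually_compose_filterlim)
  then show "locally_zero_on Y Q (\<Psi> z)"
    unfolding locally_zero_on_def using ev by eventually_elim (use \<Phi>_slice in auto)
qed

text \<open>The preimage under \<Phi> of a ball serves as \<open>T\<close>: the ball is connected,
  so the identity theorem carries vanishing from the image of one point to that of any
  other.\<close>

lemma locally_zero_spreads:
  assumes "y \<in> Y" "y \<in> V"
  obtains T where "openin (top_of_set Y) T" "y \<in> T"
    "\<And>x x'. x \<in> T \<Longrightarrow> x' \<in> T \<Longrightarrow> locally_zero_on Y Q x \<Longrightarrow> locally_zero_on Y Q x'"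
proof -
  note \<Phi>y = \<Phi>_slice[OF assms]
  have "\<Phi> y \<in> proj -` W" using \<Phi>y by simp
  then obtain r where r: "r > 0" "ball (\<Phi> y) r \<subseteq> proj -` W"
    using open_proj_vimage[OF open_W] open_contains_ball by blast
  define T where "T = Y \<inter> (V \<inter> \<Phi> -` ball (\<Phi> y) r)"
  have "open (V \<inter> \<Phi> -` ball (\<Phi> y) r)"
    using homeo by (intro continuous_open_preimage open_V open_ball) (auto simp: homeomorphism_def)
  then have "openin (top_of_set Y) T" unfolding T_def by (rule openin_open_Int)
  moreover have "y \<in> T" using assms r by (simp add: T_def)
  moreover have "locally_zero_on Y Q x'" if x: "x \<in> T" and x': "x' \<in> T" and "locally_zero_on Y Q x" for x x'
  proof -
    have *: "u \<in> Y" "u \<in> V" "\<Phi> u \<in> ball (\<Phi> y) r" if "u \<in> T" for u using that by (auto simp: T_def)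
    note sx = \<Phi>_slice[OF *(1,2)[OF x]] and sx' = \<Phi>_slice[OF *(1,2)[OF x']]
    have "\<forall>\<^sub>F w in nhds (\<Phi> x). mpoly_eval Q (\<Psi> (proj w)) = 0"
      using that(3) locally_zero_iff[OF sx(1,2)] sx(3) by simp
    then have "mpoly_eval Q (\<Psi> (proj w)) = 0" if "w \<in> ball (\<Phi> y) r" for w
      by (intro line_analytic_identity[of "ball (\<Phi> y) r" "\<lambda>w. mpoly_eval Q (\<Psi> (proj w))" "\<Phi> x"]
            line_analytic_mpoly) (use r(2) *[OF x] that in auto)
    moreover have "\<forall>\<^sub>F w in nhds (\<Phi> x'). w \<in> ball (\<Phi> y) r"
      by (rule eventually_nhds_in_open) (use *[OF x'] in auto)
    ultimately have "\<forall>\<^sub>F w in nhds (\<Phi> x'). mpoly_eval Q (\<Psi> (proj w)) = 0"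
      by (auto elim: eventually_mono)
    then show ?thesis using locally_zero_iff[OF sx'(1,2)] sx'(3) by simp
  qed
  ultimately show ?thesis by (rule that)
qed

text \<open>In a closed ball the nonvanishing sets of the countably many nonzero polynomials are
  relatively open and dense, so Baire's theorem gives a common point, which is then projected to the
  slice.\<close>

lemma exists_nonalgebraic_slice_point:
  assumes nz: "\<And>Q z. Q \<noteq> 0 \<Longrightarrow> z \<in> W \<Longrightarrow> proj z = z \<Longrightarrow> \<not> locally_zero_on Y Q (\<Psi> z)"
    and z0: "z0 \<in> W" "proj z0 = z0" and O': "open O'" "\<Psi> z0 \<in> O'"
  obtains p where "p \<in> W" "proj p = p" "\<Psi> p \<in> O'" "\<And>Q. Q \<noteq> 0 \<Longrightarrow> mpoly_eval Q (\<Psi> p) \<noteq> 0"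
proof -
  define h where "h Q z = mpoly_eval Q (\<Psi> (proj z))" for Q z
  define N where "N = (proj -` W) \<inter> (\<lambda>z. \<Psi> (proj z)) -` O'"
  have "open N" unfolding N_def
    by (rule continuous_open_preimage[OF continuous_on_\<Psi>_proj open_proj_vimage[OF open_W] O'(1)])
  moreover have "z0 \<in> N" using z0 O' by (simp add: N_def)
  ultimately obtain r where r: "r > 0" "cball z0 r \<subseteq> N" using open_contains_cball by blast
  have nzh: "\<not> (\<forall>\<^sub>F w in nhds z. h Q w = 0)" if "Q \<noteq> 0" "z \<in> N" for Q z
  proof
    assume zero: "\<forall>\<^sub>F w in nhds z. h Q w = 0"
    \<comment> \<open>\<open>h Q\<close> depends only on the projection of its argument. Translation
      therefore moves local vanishing from \<open>z\<close> to the slice point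
      \<open>proj z\<close>, about which \<open>nz\<close> speaks.\<close>
    have "((\<lambda>w. z + (w - proj z)) \<longlongrightarrow> z + (proj z - proj z)) (nhds (proj z))"
      by (intro tendsto_intros filterlim_ident)
    then have "((\<lambda>w. z + (w - proj z)) \<longlongrightarrow> z) (nhds (proj z))" by simp
    with zero have "\<forall>\<^sub>F w in nhds (proj z). h Q (z + (w - proj z)) = 0"
      by (rule eventually_compose_filterlim)
    moreover have "h Q (z + (w - proj z)) = h Q w" for w
      by (simp add: h_def linear_add[OF linear_proj] linear_diff[OF linear_proj])
    ultimately have "locally_zero_on Y Q (\<Psi> (proj z))"
      using that(2) by (subst locally_zero_iff) (auto simp: N_def h_def)
    then show False using nz[of Q "proj z"] that by (auto simp: N_def)
  qed
  define \<G> where "\<G> = (\<lambda>Q. {z \<in> cball z0 r. h Q z \<noteq> 0}) ` {Q. Q \<noteq> 0}"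
  have "cball z0 r \<subseteq> closure (\<Inter>\<G>)"
  proof (rule Baire)
    show "countable \<G>" unfolding \<G>_def
      by (rule countable_image) (rule countable_subset[OF _ countable_int_mpoly], simp)
    fix T assume "T \<in> \<G>"
    then obtain Q where Q: "Q \<noteq> 0" "T = {z \<in> cball z0 r. h Q z \<noteq> 0}" by (auto simp: \<G>_def)
    have "continuous_on (cball z0 r) (h Q)"
    proof (intro continuous_at_imp_continuous_on ballI)
      fix z assume "z \<in> cball z0 r"
      then have "proj z \<in> W" using r by (auto simp: N_def)
      from line_analytic_isCont[OF line_analytic_mpoly[OF this]]
      show "isCont (h Q) z" unfolding h_def .
    qed
    then have "openin (top_of_set (cball z0 r)) (cball z0 r \<inter> h Q -` (- {0}))"
      by (intro continuous_openin_preimage_gen) auto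
    moreover have "cball z0 r \<inter> h Q -` (- {0}) = T" using Q by auto
    moreover have "cball z0 r \<subseteq> closure T"
    proof -
      have "ball z0 r \<subseteq> closure T"
      proof
        fix z assume z: "z \<in> ball z0 r"
        then have "\<not> (\<forall>\<^sub>F w in nhds z. h Q w = 0)" using nzh[OF Q(1), of z] r ball_subset_cball by blast
        then have *: "\<exists>w\<in>S. h Q w \<noteq> 0" if "open S" "z \<in> S" for S
          using that by (auto simp: eventually_nhds)
        show "z \<in> closure T"
        proof (subst closure_iff_nhds_not_empty, intro allI impI)
          fix A S :: "(real ^ 'n) set" assume S: "S \<subseteq> A" "open S" "z \<in> S"
          obtain w where "w \<in> S \<inter> ball z0 r" "h Q w \<noteq> 0" using *[OF open_Int[OF S(2) open_ball[of z0 r]]] S z by blast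
          then have "w \<in> T \<inter> A" using Q(2) S by auto
          then show "T \<inter> A \<noteq> {}" by blast
        qed
      qed
      then have "closure (ball z0 r) \<subseteq> closure T" by (simp add: closure_minimal)
      then show ?thesis using r by simp
    qed
    ultimately show "openin (top_of_set (cball z0 r)) T \<and> cball z0 r \<subseteq> closure T" by simp
  qed simp
  then have "\<Inter>\<G> \<noteq> {}" using r(1) by (cases "\<Inter>\<G> = {}") auto
  then obtain p where p: "p \<in> \<Inter>\<G>" by blast
  \<comment> \<open>The member of the family that belongs to the constant 1 records that
    \<open>p\<close> lies in the closed ball.\<close>
  have "(1 :: 'n int_mpoly) \<noteq> 0" by simp
  then have "{z \<in> cball z0 r. h 1 z \<noteq> 0} \<in> \<G>" unfolding \<G>_def by blast
  then have "p \<in> cball z0 r" using p by blast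
  then have "p \<in> N" using r by blast
  then show ?thesis using p by (intro that[of "proj p"]) (auto simp: N_def \<G>_def h_def)
qed

end

lemma real_analytic_submanifold_chart:
  fixes Y :: "(real ^ 'n::finite) set"
  assumes "real_analytic_submanifold d Y" "a \<in> Y"
  obtains V W \<Phi> \<Psi> I where "slice_chart Y V W \<Phi> \<Psi> I" "a \<in> V" "card I = d"
proof -
  have "\<exists>V W \<Phi> \<Psi>. \<exists>I :: 'n set.
       open V \<and> a \<in> V \<and> open W \<and> homeomorphism V W \<Phi> \<Psi> \<and>
       real_analytic_on \<Phi> V \<and> real_analytic_on \<Psi> W \<and>
       card I = d \<and> \<Phi> ` (Y \<inter> V) = W \<inter> {z. \<forall>i. i \<notin> I \<longrightarrow> z $ i = 0}"
    using assms unfolding real_analytic_submanifold_def by (rule bspec)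
  then show ?thesis
  proof (elim exE conjE)
    fix V W \<Phi> \<Psi> and I :: "'n set"
    assume "open V" "a \<in> V" "open W" "homeomorphism V W \<Phi> \<Psi>" "real_analytic_on \<Phi> V"
      "real_analytic_on \<Psi> W" "card I = d" "\<Phi> ` (Y \<inter> V) = W \<inter> {z. \<forall>i. i \<notin> I \<longrightarrow> z $ i = 0}"
    then show ?thesis by (intro that[of V W \<Phi> \<Psi> I]) (simp_all add: slice_chart_def)
  qed
qed

text \<open>Transcendence only excludes vanishing on all of \<open>Y\<close>; connectedness of
  \<open>Y\<close> makes local vanishing global.\<close>

lemma locally_zero_imp_zero:
  assumes "real_analytic_submanifold d Y" "connected Y" "y \<in> Y" "locally_zero_on Y Q y" "x \<in> Y"
  shows "mpoly_eval Q x = 0"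
proof -
  have "locally_zero_on Y Q x"
  proof (rule connected_induction_simple[OF assms(2,3,5), of "locally_zero_on Y Q"])
    fix a assume a: "a \<in> Y"
    obtain V W \<Phi> \<Psi> I where "slice_chart Y V W \<Phi> \<Psi> I" "a \<in> V"
      by (rule real_analytic_submanifold_chart[OF assms(1) a])
    then interpret slice_chart Y V W \<Phi> \<Psi> I by simp
    show "\<exists>T. openin (top_of_set Y) T \<and> a \<in> T \<and>
        (\<forall>x\<in>T. \<forall>y\<in>T. locally_zero_on Y Q x \<longrightarrow> locally_zero_on Y Q y)"
      by (rule locally_zero_spreads[OF a \<open>a \<in> V\<close>, of Q]) blast
  qed (rule assms(4))
  then show ?thesis using assms(5) unfolding locally_zero_on_def by (auto dest: eventually_nhds_x_imp_x)
qed

section \<open>Uniform points on submanifolds\<close>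

lemma nowhere_locally_zero:
  fixes h :: "'a::real_normed_vector \<Rightarrow> real"
  assumes "open U" "connected U" "\<And>x. x \<in> U \<Longrightarrow> line_analytic_at h x" "a \<in> U" "h a \<noteq> 0" "x \<in> U"
  shows "\<not> (\<forall>\<^sub>F u in nhds x. h u = 0)"
proof
  assume "\<forall>\<^sub>F u in nhds x. h u = 0"
  from line_analytic_identity[OF assms(1-3) assms(6) this assms(4)] assms(5) show False by simp
qed

text \<open>Avoiding an arbitrary countable \<open>C\<close> is what yields uncountability. The
  parameter plane is centred at a point where no nonzero polynomial vanishes, so by the identity
  theorem none vanishes identically near any point of the connected domain \<open>U\<close>.\<close>

lemma exists_uniform_point_avoiding:
  fixes Y :: "(real ^ 'n::finite) set" and f :: "nat \<Rightarrow> real \<Rightarrow> real"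
  assumes d: "d \<ge> 2" and Y: "real_analytic_submanifold d Y" "connected Y" "transcendental_set Y"
    and pos: "\<And>k t. k \<ge> 1 \<Longrightarrow> t > 0 \<Longrightarrow> f k t > 0"
    and anti: "\<And>k. k \<ge> 1 \<Longrightarrow> antimono_on {0<..} (f k)"
    and y: "y \<in> Y" and O': "open O'" "y \<in> O'" and C: "countable C"
  obtains x where "x \<in> Y" "x \<in> O'" "x \<notin> C" "\<not> algebraic_point x" "\<And>k. k \<ge> 1 \<Longrightarrow> f_uniform (f k) k x"
proof -
  obtain V W \<Phi> \<Psi> I where chart: "slice_chart Y V W \<Phi> \<Psi> I" "y \<in> V" "card I = d"
    by (rule real_analytic_submanifold_chart[OF Y(1) y])
  interpret slice_chart Y V W \<Phi> \<Psi> I by (rule chart(1))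
  have nz: "\<not> locally_zero_on Y Q x" if "Q \<noteq> 0" "x \<in> Y" for Q x
    using locally_zero_imp_zero[OF Y(1,2) that(2)] that(1) Y(3) unfolding transcendental_set_def by blast
  note \<Phi>y = \<Phi>_slice[OF y chart(2)]
  obtain p where p: "p \<in> W" "proj p = p" "\<Psi> p \<in> O'" "\<And>Q. Q \<noteq> 0 \<Longrightarrow> mpoly_eval Q (\<Psi> p) \<noteq> 0"
    by (rule exists_nonalgebraic_slice_point[OF _ \<Phi>y(1,2) O'(1)]) (use nz \<Psi>_slice \<Phi>y O' in auto)
  have "\<not> card I \<le> Suc 0" using chart(3) d by simp
  then obtain i1 i2 where i: "i1 \<in> I" "i2 \<in> I" "i1 \<noteq> i2" by (auto simp: card_le_Suc0_iff_eq)
  \<comment> \<open>Two coordinate directions of the slice span the plane; as d \<ge> 2 they exist,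
    and \<open>projA\<close> records that the plane stays in the slice.\<close>
  define A :: "real \<times> real \<Rightarrow> real ^ 'n" where "A u = fst u *\<^sub>R axis i1 1 + snd u *\<^sub>R axis i2 1" for u
  have "linear A" by (rule linearI) (auto simp: A_def algebra_simps)
  then have A: "bounded_linear A" by (simp add: linear_conv_bounded_linear)
  have A0: "A 0 = 0" and A10: "A (1,0) = axis i1 1" and A01: "A (0,1) = axis i2 1"
    by (simp_all add: A_def)
  have projA: "proj (A u + p) = A u + p" for u
    using p(2) i unfolding proj_eq_iff by (auto simp: A_def axis_def)
  define G where "G u = \<Psi> (proj (A u + p))" for u
  define N where "N = (\<lambda>u. A u + p) -` (proj -` W \<inter> (\<lambda>z. \<Psi> (proj z)) -` O')"
  have contA: "continuous_on UNIV (\<lambda>u. A u + p)"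
    by (intro continuous_intros linear_continuous_on A)
  have "open N" unfolding N_def
    by (intro open_vimage[OF _ contA] continuous_open_preimage[OF continuous_on_\<Psi>_proj]
          open_proj_vimage open_W O'(1))
  moreover have "0 \<in> N" using p by (simp add: N_def A0)
  ultimately obtain s where s: "s > 0" "ball 0 s \<subseteq> N" using open_contains_ball by blast
  define U :: "(real \<times> real) set" where "U = ball 0 s"
  have U: "open U" "connected U" "0 \<in> U" using s by (auto simp: U_def)
  have UW: "proj (A u + p) \<in> W" and GO: "G u \<in> O'" if "u \<in> U" for u
    using that s(2) unfolding U_def N_def G_def by auto
  have GY: "G u \<in> Y" if "u \<in> U" for u
    unfolding G_def using \<Psi>_slice(1)[OF UW[OF that]] by simp
  have G0: "G 0 = \<Psi> p" by (simp add: G_def A0 p(2))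
  have anG: "line_analytic_at (\<lambda>u. G u $ i) u" if "u \<in> U" for u i
    unfolding G_def
    by (rule line_analytic_at_compose_affine[OF line_analytic_component A]) (rule UW[OF that])
  obtain D\<Psi> where D\<Psi>: "(\<Psi> has_derivative D\<Psi>) (at p)"
    using real_analytic_on_differentiable[OF analytic_\<Psi> p(1)] unfolding differentiable_def by blast
  obtain D\<Phi> where D\<Phi>: "(\<Phi> has_derivative D\<Phi>) (at (\<Psi> p))"
    using real_analytic_on_differentiable[OF analytic_\<Phi> \<Psi>_slice(2)[OF p(1,2)]]
    unfolding differentiable_def by blast
  have "((\<lambda>x. \<Phi> (\<Psi> x)) has_derivative (\<lambda>v. D\<Phi> (D\<Psi> v))) (at p)"
    by (rule has_derivative_compose[OF D\<Psi> D\<Phi>])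
  moreover have "\<Phi> (\<Psi> x) = x" if "x \<in> W" for x using homeo that by (auto simp: homeomorphism_def)
  ultimately have "((\<lambda>x. x) has_derivative (\<lambda>v. D\<Phi> (D\<Psi> v))) (at p)"
    by (rule has_derivative_transform_within_open[OF _ open_W p(1)])
  from has_derivative_unique[OF this has_derivative_ident]
  have inv: "D\<Phi> (D\<Psi> v) = v" for v by (rule fun_cong)
  have linD\<Phi>: "linear D\<Phi>" by (rule has_derivative_linear[OF D\<Phi>])
  have DG: "(G has_derivative (\<lambda>v. D\<Psi> (A v))) (at 0)"
  proof -
    have "((\<lambda>u. A u + p) has_derivative A) (at 0)"
      by (auto intro!: derivative_eq_intros bounded_linear_imp_has_derivative A)
    from has_derivative_compose[OF this, of \<Psi> D\<Psi>] show ?thesis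
      using D\<Psi> by (simp add: G_def[abs_def] projA A0)
  qed
  define v1 where "v1 = D\<Psi> (axis i1 1)"
  define v2 where "v2 = D\<Psi> (axis i2 1)"
  \<comment> \<open>By the chain rule D\<Psi> has the left inverse D\<Phi>, so \<open>v1\<close> and
    \<open>v2\<close> are independent and some 2 by 2 minor is nonzero. Its rows \<open>j\<close>
    and \<open>j'\<close> are the ambient coordinates that restrict to local coordinates.\<close>
  obtain j j' where det: "v1 $ j * v2 $ j' - v2 $ j * v1 $ j' \<noteq> 0"
  proof (rule ccontr)
    assume "\<not> thesis"
    then have 0: "v1 $ j * v2 $ j' = v2 $ j * v1 $ j'" for j j' using that[of j j'] by force
    have "v1 \<noteq> 0"
    proof
      assume "v1 = 0"
      then have "axis i1 (1::real) = 0" using inv[of "axis i1 1"] linear_0[OF linD\<Phi>] by (simp add: v1_def)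
      then show False by simp
    qed
    then obtain j where j: "v1 $ j \<noteq> 0" by (auto simp: vec_eq_iff)
    then have "v2 = (v2 $ j / v1 $ j) *\<^sub>R v1" using 0[of j] by (auto simp: vec_eq_iff field_simps)
    then have "D\<Phi> v2 = (v2 $ j / v1 $ j) *\<^sub>R D\<Phi> v1" by (metis linear_scale[OF linD\<Phi>])
    then have "axis i2 (1::real) = (v2 $ j / v1 $ j) *\<^sub>R axis i1 1" by (simp only: v1_def v2_def inv)
    then have "axis i2 (1::real) $ i2 = ((v2 $ j / v1 $ j) *\<^sub>R axis i1 1) $ i2" by simp
    then show False using i by (simp add: axis_def)
  qed
  have DGi: "((\<lambda>u. G u $ i) has_derivative (\<lambda>v. D\<Psi> (A v) $ i)) (at 0)" for i
    by (rule bounded_linear.has_derivative[OF bounded_linear_vec_nth DG])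
  \<comment> \<open>To miss a point \<open>c\<close> it is enough to differ from it in coordinate
    \<open>j\<close>, which is not constant on the plane because its differential is a row of the
    nonzero minor.\<close>
  define family where "family = (\<lambda>Q u. mpoly_eval Q (G u)) ` {Q. Q \<noteq> 0} \<union> (\<lambda>c u. G u $ j - c $ j) ` C"
  have family: "line_analytic_at h x \<and> \<not> (\<forall>\<^sub>F u in nhds x. h u = 0)"
    if h: "h \<in> family" and x: "x \<in> U" for h x
  proof -
    from h consider Q where "Q \<noteq> 0" "h = (\<lambda>u. mpoly_eval Q (G u))" | c where "h = (\<lambda>u. G u $ j - c $ j)"
      unfolding family_def by blast
    then have "(\<forall>u\<in>U. line_analytic_at h u) \<and> (\<exists>a\<in>U. h a \<noteq> 0)"
    proof cases
      case 1
      then have "h 0 \<noteq> 0" using p(4) by (simp add: G0)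
      moreover have "line_analytic_at h u" if "u \<in> U" for u
        unfolding 1 by (rule line_analytic_at_mpoly_eval[of G]) (rule anG[OF that])
      ultimately show ?thesis using U by blast
    next
      case 2
      have "line_analytic_at h u" if "u \<in> U" for u
        unfolding 2 using line_analytic_at_add[OF anG[OF that, of j] line_analytic_at_const[of "- c $ j"]] by simp
      moreover have "\<exists>a\<in>U. h a \<noteq> 0"
      proof (rule ccontr)
        assume "\<not> (\<exists>a\<in>U. h a \<noteq> 0)"
        then have "G u $ j = c $ j" if "u \<in> U" for u using that 2 by auto
        then have "((\<lambda>u. c $ j) has_derivative (\<lambda>v. D\<Psi> (A v) $ j)) (at 0)"
          by (rule has_derivative_transform_within_open[OF DGi U(1,3)])
        then have "(\<lambda>v. D\<Psi> (A v) $ j) = (\<lambda>v. 0)" using has_derivative_unique has_derivative_const by blast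
        then have "D\<Psi> (A (1,0)) $ j = 0" "D\<Psi> (A (0,1)) $ j = 0" by meson+
        then show False using det by (simp add: A10 A01 v1_def v2_def)
      qed
      ultimately show ?thesis by blast
    qed
    then show ?thesis using nowhere_locally_zero[OF U(1,2) _ _ _ x] x by blast
  qed
  have "countable family" unfolding family_def
    by (intro countable_Un countable_image C countable_subset[OF _ countable_int_mpoly]) simp
  moreover have "(1 :: 'n int_mpoly) \<noteq> 0" by simp
  then have "family \<noteq> {}" unfolding family_def by blast
  ultimately have enum: "from_nat_into family ` UNIV = family" by (simp add: range_from_nat_into)
  then have fam_i: "from_nat_into family i \<in> family" for i by blast
  show ?thesis
  proof (rule rational_grid_coordinates[OF U(1,3) anG[OF U(3), of j] anG[OF U(3), of j'] DGi DGi])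
    show "D\<Psi> (A (1, 0)) $ j * D\<Psi> (A (0, 1)) $ j' - D\<Psi> (A (0, 1)) $ j * D\<Psi> (A (1, 0)) $ j' \<noteq> 0"
      using det by (simp add: A10 A01 v1_def v2_def)
    fix V' g
    assume V': "open V'" "V' \<noteq> {}" "g ` V' \<subseteq> U" "continuous_on V' g"
      and g: "\<And>q. q \<in> V' \<Longrightarrow> G (g q) $ j = fst q" "\<And>q. q \<in> V' \<Longrightarrow> G (g q) $ j' = snd q"
      and good: "\<And>h o' c \<epsilon>. \<forall>x\<in>U. line_analytic_at h x \<and> \<not> (\<forall>\<^sub>F y in nhds x. h y = 0) \<Longrightarrow> c \<in> V' \<Longrightarrow> \<epsilon> > 0 \<Longrightarrow>
       \<exists>t\<in>\<rat>. \<forall>\<delta>>0. \<exists>p\<in>V'. dist p c < \<epsilon> \<and>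
        coord (\<not> o') p = t \<and> \<bar>coord o' p - coord o' c\<bar> < \<delta> \<and> h (g p) \<noteq> 0"
    show ?thesis
    proof (rule exists_uniform_nonvanishing_point[of V' "\<lambda>i q. from_nat_into family i (g q)" f])
      show "open V'" "V' \<noteq> {}" by fact+
      show "f m t > 0" if "m \<ge> 1" "t > 0" for m t using that by (rule pos)
      show "antimono_on {0<..} (f m)" if "m \<ge> 1" for m using that by (rule anti)
      show "continuous_on V' (\<lambda>q. from_nat_into family i (g q))" for i
      proof (rule continuous_on_compose2[OF _ V'(4,3)])
        show "continuous_on U (from_nat_into family i)"
          using family[OF fam_i] line_analytic_isCont by (blast intro: continuous_at_imp_continuous_on)
      qed
      show "\<exists>t\<in>\<rat>. \<forall>\<delta>>0. \<exists>p\<in>V'. dist p c < \<epsilon> \<and> coord (\<not> o') p = t \<and>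
          \<bar>coord o' p - coord o' c\<bar> < \<delta> \<and> from_nat_into family i (g p) \<noteq> 0"
        if "c \<in> V'" "\<epsilon> > 0" for i o' c \<epsilon>
        by (rule good[OF _ that]) (use family[OF fam_i] in blast)
      fix q
      assume q: "q \<in> V'" and nzq: "\<And>i. from_nat_into family i (g q) \<noteq> 0"
        and unif: "\<And>m. m \<ge> 1 \<Longrightarrow> \<forall>\<^sub>F t in at_top. \<exists>o' (a::int) (b::int). b > 0 \<and> of_int \<bar>a\<bar> \<le> t \<and> of_int b \<le> t \<and>
          \<bar>of_int b * coord o' q - of_int a\<bar> \<le> f m t"
      have gq: "g q \<in> U" using q V' by blast
      have nzf: "h (g q) \<noteq> 0" if "h \<in> family" for h
        using that nzq enum by (metis imageE)
      show ?thesis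
      proof (rule that[of "G (g q)"])
        show "G (g q) \<in> Y" "G (g q) \<in> O'" using GY[OF gq] GO[OF gq] .
        show "G (g q) \<notin> C"
        proof
          assume "G (g q) \<in> C"
          then have "(\<lambda>u. G u $ j - G (g q) $ j) \<in> family" unfolding family_def by blast
          from nzf[OF this] show False by simp
        qed
        have "mpoly_eval Q (G (g q)) \<noteq> 0" if "Q \<noteq> 0" for Q
          using nzf[of "\<lambda>u. mpoly_eval Q (G u)"] that unfolding family_def by blast
        then show "\<not> algebraic_point (G (g q))" by (auto simp: algebraic_point_def k_algebraic_def)
        fix m :: nat assume m: "m \<ge> 1"
        show "f_uniform (f m) m (G (g q))"
        proof (rule f_uniform_if_near_rational_hyperplanes[OF _ m])
          \<comment> \<open>Closeness to grid lines in the plane is smallness of a form b X_i - a in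
            the ambient coordinate \<open>j\<close> or \<open>j'\<close>.\<close>
          have "coord o' q = G (g q) $ (if o' then j else j')" for o'
            using g[OF q] by (simp add: coord_def)
          with unif[OF m] show "\<forall>\<^sub>F t in at_top. \<exists>i (a::int) (b::int). b > 0 \<and> of_int \<bar>a\<bar> \<le> t \<and> of_int b \<le> t \<and>
              \<bar>of_int b * G (g q) $ i - of_int a\<bar> \<le> f m t"
            by (auto elim!: eventually_mono)
        qed
      qed
    qed
  qed
qed

section \<open>Density, uncountability and singular points\<close>

lemma dense_uncountable_uniform_points:
  fixes Y :: "(real ^ 'n::finite) set" and f :: "nat \<Rightarrow> real \<Rightarrow> real"
  assumes "d \<ge> 2" "real_analytic_submanifold d Y" "connected Y" "transcendental_set Y"
    and "\<And>k t. k \<ge> 1 \<Longrightarrow> t > 0 \<Longrightarrow> f k t > 0"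
    and "\<And>k. k \<ge> 1 \<Longrightarrow> antimono_on {0<..} (f k)"
  shows "\<exists>S\<subseteq>Y. uncountable S \<and> Y \<subseteq> closure S \<and>
            (\<forall>x\<in>S. \<not> algebraic_point x \<and> (\<forall>k\<ge>1. f_uniform (f k) k x))"
proof -
  define S where "S = {x\<in>Y. \<not> algebraic_point x \<and> (\<forall>k\<ge>1. f_uniform (f k) k x)}"
  have ex: "\<exists>x\<in>S. x \<in> O' \<and> x \<notin> C" if "y \<in> Y" "open O'" "y \<in> O'" "countable C" for y O' C
    by (rule exists_uniform_point_avoiding[OF assms that]) (auto simp: S_def)
  have "(1 :: 'n int_mpoly) \<noteq> 0" by simp
  then have "Y \<noteq> {}" using assms(4) unfolding transcendental_set_def by blast
  then obtain y where y: "y \<in> Y" by blast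
  \<comment> \<open>A countable \<open>S\<close> could itself be taken as the set to avoid.\<close>
  have "uncountable S" using ex[OF y open_UNIV UNIV_I, of S] by blast
  moreover have "Y \<subseteq> closure S"
  proof
    fix y assume "y \<in> Y"
    then show "y \<in> closure S"
      using ex[OF _ _ _ countable_empty] by (subst closure_iff_nhds_not_empty) blast
  qed
  ultimately show ?thesis by (intro exI[of _ S]) (auto simp: S_def)
qed

lemma f_uniform_mono:
  assumes "f_uniform f k x" "\<forall>\<^sub>F t in at_top. f t \<le> g t"
  shows "f_uniform g k x"
  using assms unfolding f_uniform_def
proof eventually_elim
  case (elim t)
  then obtain P where "P \<noteq> 0 \<and> mpoly_degree P \<le> k \<and> of_int (mpoly_height P) \<le> t \<and> \<bar>mpoly_eval P x\<bar> \<le> f t"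
    by (elim exE)
  then show ?case using elim by (intro exI[of _ P]) linarith
qed

text \<open>One extra factor 1/t lies below any given \<epsilon> once t \<ge> 1/\<epsilon>, so a
  single function handles all \<epsilon>.\<close>

lemma k_singular_if_uniform:
  fixes x :: "real ^ 'n::finite"
  assumes "f_uniform (\<lambda>t. t powr - (real (N_exp k CARD('n)) + 1)) k x"
  shows "k_singular k x"
  unfolding k_singular_def
proof (intro allI impI f_uniform_mono[OF assms])
  fix \<epsilon> :: real assume "\<epsilon> > 0"
  show "\<forall>\<^sub>F t in at_top. t powr - (real (N_exp k CARD('n)) + 1) \<le> \<epsilon> * t powr - real (N_exp k CARD('n))"
    using eventually_ge_at_top[of "1 / \<epsilon>"] eventually_gt_at_top[of 0]
  proof eventually_elim
    case (elim t)
    have "t powr - (real (N_exp k CARD('n)) + 1) = t powr - real (N_exp k CARD('n)) / t"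
      using elim powr_diff[of t "- real (N_exp k CARD('n))" 1] by simp
    also have "\<dots> = (1 / t) * t powr - real (N_exp k CARD('n))" by simp
    also have "\<dots> \<le> \<epsilon> * t powr - real (N_exp k CARD('n))"
      using elim \<open>\<epsilon> > 0\<close> by (intro mult_right_mono) (auto simp: field_simps)
    finally show ?case .
  qed
qed

theorem theorem5p1:
  fixes Y :: "(real ^ 'n) set" and d :: nat and f :: "nat \<Rightarrow> real \<Rightarrow> real"
  assumes "CARD('n) \<ge> 2"
    and "d \<ge> 2"
    and "real_analytic_submanifold d Y"
    and "connected Y"
    and "transcendental_set Y"
    and "\<And>k t. k \<ge> 1 \<Longrightarrow> t > 0 \<Longrightarrow> f k t > 0"
    and "\<And>k. k \<ge> 1 \<Longrightarrow> antimono_on {0<..} (f k)"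
  shows "(\<exists>S\<subseteq>Y. uncountable S \<and> Y \<subseteq> closure S \<and>
            (\<forall>x\<in>S. \<not> algebraic_point x \<and> (\<forall>k\<ge>1. f_uniform (f k) k x)))
       \<and> (\<exists>S\<subseteq>Y. uncountable S \<and> Y \<subseteq> closure S \<and>
            (\<forall>x\<in>S. \<not> algebraic_point x \<and> (\<forall>k\<ge>1. k_singular k x)))"
proof
  show "\<exists>S\<subseteq>Y. uncountable S \<and> Y \<subseteq> closure S \<and>
            (\<forall>x\<in>S. \<not> algebraic_point x \<and> (\<forall>k\<ge>1. f_uniform (f k) k x))"
    using assms(2-7) by (rule dense_uncountable_uniform_points)
  have "\<exists>S\<subseteq>Y. uncountable S \<and> Y \<subseteq> closure S \<and> (\<forall>x\<in>S. \<not> algebraic_point x \<and>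
      (\<forall>k\<ge>1. f_uniform (\<lambda>t. t powr - (real (N_exp k CARD('n)) + 1)) k x))"
    by (rule dense_uncountable_uniform_points[OF assms(2-5)])
       (auto intro!: monotone_onI powr_mono2')
  then show "\<exists>S\<subseteq>Y. uncountable S \<and> Y \<subseteq> closure S \<and>
            (\<forall>x\<in>S. \<not> algebraic_point x \<and> (\<forall>k\<ge>1. k_singular k x))"
    by (elim exE conjE, intro exI conjI ballI allI impI) (auto intro: k_singular_if_uniform)
qed

end
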